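(* Let $n\ge 1$ and $d\ge 3$, and let $f,g\in\mathbb{C}[x_0,\dots,x_n]$ be two homogeneous polynomials of degree $d$. If $J_f=J_g$, $V(f)\neq V(g)$ (i.e. $f\notin\mathbb{C}^*g$), and $V(f)$ does not admit any singularities of multiplicity $d-1$, then $f$ is of Sebastiani-Thom type.
   Context: Work over $\mathbb{C}$; $S=\mathbb{C}[x_0,\dots,x_n]$ with its standard grading. A homogeneous polynomial of degree $d$ is understood to be nonzero. For a homogeneous polynomial $f\in S$, $J_f$ is the Jacobian ideal, i.e. the homogeneous ideal of $S$ generated by the first order partial derivatives $f_i=\partial f/\partial x_i$, $i=0,\dots,n$. $V(f)\subset\mathbb{P}^n$ is the projective hypersurface $f=0$, taken with its scheme structure (so $V(f)\ne V(g)$ means precisely $f\notin\mathbb{C}^*g$). A point $p\in V(f)$ has multiplicity $m$ if a local equation of $V(f)$ at $p$ lies in $\mathfrak{m}_p^m$ but not in $\mathfrak{m}_p^{m+1}$; it is a singularity if $m\ge 2$. A homogeneous polynomial $f$ of degree $d$ is of Sebastiani-Thom type (ST type) if, for some choice of homogeneous (linear) coordinates $(x_0,\dots,x_n)$ of $\mathbb{P}^n$, some $0\le l\le n-1$, and some forms $g,h$, each either zero or homogeneous of degree $d$, one has $f(x_0,\dots,x_n)=g(x_0,\dots,x_l)+h(x_{l+1},\dots,x_n)$. The case $h=0$ is allowed (then $f$ is called a cone). *)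

theory Defs
  imports
    "HOL-Library.Poly_Mapping"
    "HOL-Computational_Algebra.Fraction_Field"
    "HOL-Algebra.Ideal_Product"
    "Jordan_Normal_Form.Matrix"
begin

section \<open>Complex polynomials in finitely many of countably many variables\<close>

text \<open>
  A monomial is a finitely supported exponent function, a polynomial is a finitely supported
  coefficient function on monomials. The type has variables \<open>x\<^sub>i\<close> for all natural numbers \<open>i\<close>;
  \<open>polyring V\<close> below is the polynomial ring in the variables with index in \<open>V\<close>.
\<close>

type_synonym cpoly = "(nat \<Rightarrow>\<^sub>0 nat) \<Rightarrow>\<^sub>0 complex"

definition Const :: "complex \<Rightarrow> cpoly" where
  "Const c = Poly_Mapping.single 0 c"

definition Var :: "nat \<Rightarrow> cpoly" where
  "Var i = Poly_Mapping.single (Poly_Mapping.single i 1) 1"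

definition mon_degree :: "(nat \<Rightarrow>\<^sub>0 nat) \<Rightarrow> nat" where
  "mon_degree m = (\<Sum>i\<in>Poly_Mapping.keys m. Poly_Mapping.lookup m i)"

definition polyring :: "nat set \<Rightarrow> cpoly ring" where
  "polyring V =
     \<lparr>carrier = {f. \<forall>m\<in>Poly_Mapping.keys f. Poly_Mapping.keys m \<subseteq> V},
      monoid.mult = (*), one = 1, zero = 0, add = (+)\<rparr>"

text \<open>A form may be zero, a homogeneous polynomial may not.\<close>

definition form :: "nat set \<Rightarrow> nat \<Rightarrow> cpoly \<Rightarrow> bool" where
  "form V d f \<longleftrightarrow> f \<in> carrier (polyring V) \<and> (\<forall>m\<in>Poly_Mapping.keys f. mon_degree m = d)"

definition homogeneous :: "nat set \<Rightarrow> nat \<Rightarrow> cpoly \<Rightarrow> bool" where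
  "homogeneous V d f \<longleftrightarrow> form V d f \<and> f \<noteq> 0"

text \<open>
  In the formula below, the truncated subtraction of exponents is harmless: if \<open>x\<^sub>i\<close> does not occur
  in \<open>m\<close>, then the coefficient is zero.
\<close>

definition partial_deriv :: "nat \<Rightarrow> cpoly \<Rightarrow> cpoly" where
  "partial_deriv i f =
     (\<Sum>m\<in>Poly_Mapping.keys f. Poly_Mapping.single (m - Poly_Mapping.single i 1)
        (of_nat (Poly_Mapping.lookup m i) * Poly_Mapping.lookup f m))"

definition jacobian_ideal :: "nat \<Rightarrow> cpoly \<Rightarrow> cpoly set" where
  "jacobian_ideal n f = genideal (polyring {..n}) {partial_deriv i f | i. i \<le> n}"

definition eval_at :: "(nat \<Rightarrow> complex) \<Rightarrow> cpoly \<Rightarrow> complex" where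
  "eval_at a f = (\<Sum>m\<in>Poly_Mapping.keys f.
     Poly_Mapping.lookup f m * (\<Prod>i\<in>Poly_Mapping.keys m. a i ^ Poly_Mapping.lookup m i))"

definition substitute :: "(nat \<Rightarrow> cpoly) \<Rightarrow> cpoly \<Rightarrow> cpoly" where
  "substitute y f = (\<Sum>m\<in>Poly_Mapping.keys f.
     Const (Poly_Mapping.lookup f m) * (\<Prod>i\<in>Poly_Mapping.keys m. y i ^ Poly_Mapping.lookup m i))"


section \<open>Points of projective hypersurfaces and their multiplicities\<close>

text \<open>
  Points of projective \<open>n\<close>-space are given by their homogeneous coordinate vectors, which are
  nonzero and matter only up to scaling; all notions below are invariant under scaling.
\<close>

definition hypersurface_points :: "nat \<Rightarrow> cpoly \<Rightarrow> complex vec set" where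
  "hypersurface_points n f =
     {p \<in> carrier_vec (Suc n). p \<noteq> 0\<^sub>v (Suc n) \<and> eval_at (\<lambda>i. p $ i) f = 0}"

text \<open>
  The local ring at the point \<open>a\<close> of the affine space with coordinates \<open>x\<^sub>i\<close> for \<open>i \<in> V\<close>, realised
  inside the field of rational functions, and its maximal ideal.
\<close>

definition local_ring :: "nat set \<Rightarrow> (nat \<Rightarrow> complex) \<Rightarrow> cpoly fract ring" where
  "local_ring V a =
     \<lparr>carrier = {Fraction_Field.Fract u s | u s. u \<in> carrier (polyring V) \<and> s \<in> carrier (polyring V)
        \<and> eval_at a s \<noteq> 0},
      monoid.mult = (*), one = 1, zero = 0, add = (+)\<rparr>"

definition local_max_ideal :: "nat set \<Rightarrow> (nat \<Rightarrow> complex) \<Rightarrow> cpoly fract set" where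
  "local_max_ideal V a =
     {Fraction_Field.Fract u s | u s. u \<in> carrier (polyring V) \<and> s \<in> carrier (polyring V)
        \<and> eval_at a u = 0 \<and> eval_at a s \<noteq> 0}"

definition local_max_ideal_power ::
    "nat set \<Rightarrow> (nat \<Rightarrow> complex) \<Rightarrow> nat \<Rightarrow> cpoly fract set" where
  "local_max_ideal_power V a m = local_max_ideal V a [^]\<^bsub>ideals_set (local_ring V a)\<^esub> m"

text \<open>
  The chart \<open>x\<^sub>k \<noteq> 0\<close> is the affine space with coordinates \<open>x\<^sub>i\<close> for \<open>i \<in> {..n} - {k}\<close>. In it the
  hypersurface has the equation obtained from \<open>f\<close> by setting \<open>x\<^sub>k = 1\<close>, and \<open>p\<close> has the
  coordinates \<open>p\<^sub>i / p\<^sub>k\<close>. Local equations from different charts differ by a unit of the local ring, so the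
  choice of the chart does not matter.
\<close>

definition dehomogenize :: "nat \<Rightarrow> cpoly \<Rightarrow> cpoly" where
  "dehomogenize k f = substitute (\<lambda>i. if i = k then 1 else Var i) f"

definition has_multiplicity :: "nat \<Rightarrow> cpoly \<Rightarrow> complex vec \<Rightarrow> nat \<Rightarrow> bool" where
  "has_multiplicity n f p m \<longleftrightarrow>
     (\<exists>k\<le>n. p $ k \<noteq> 0 \<and>
        Fraction_Field.Fract (dehomogenize k f) 1
          \<in> local_max_ideal_power ({..n} - {k}) (\<lambda>i. p $ i / p $ k) m \<and>
        Fraction_Field.Fract (dehomogenize k f) 1
          \<notin> local_max_ideal_power ({..n} - {k}) (\<lambda>i. p $ i / p $ k) (Suc m))"

definition has_singularity_of_multiplicity :: "nat \<Rightarrow> cpoly \<Rightarrow> nat \<Rightarrow> bool" where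
  "has_singularity_of_multiplicity n f m \<longleftrightarrow>
     2 \<le> m \<and> (\<exists>p\<in>hypersurface_points n f. has_multiplicity n f p m)"


section \<open>Polynomials of Sebastiani-Thom type\<close>

text \<open>
  The new homogeneous coordinates are the linear forms given by the rows of an invertible matrix.
\<close>

definition linear_coordinate :: "nat \<Rightarrow> complex mat \<Rightarrow> nat \<Rightarrow> cpoly" where
  "linear_coordinate n A i = (\<Sum>j\<le>n. Const (A $$ (i, j)) * Var j)"

definition sebastiani_thom_type :: "nat \<Rightarrow> nat \<Rightarrow> cpoly \<Rightarrow> bool" where
  "sebastiani_thom_type n d f \<longleftrightarrow>
     (\<exists>A l g h. A \<in> carrier_mat (Suc n) (Suc n) \<and> invertible_mat A \<and> l < n \<and>
        form {..l} d g \<and> form {Suc l..n} d h \<and>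
        f = substitute (linear_coordinate n A) g + substitute (linear_coordinate n A) h)"

end

theory Submission
  imports Defs "Jordan_Normal_Form.Jordan_Normal_Form_Existence"
begin

text \<open>
  Write \<open>D\<^sub>v\<close> for the derivative in the constant direction \<open>v\<close>. In degree \<open>d - 1\<close>, the equality of the
  Jacobian ideals yields a matrix \<open>T\<close> with \<open>D\<^sub>v g = D\<^bsub>T v\<^esub> f\<close> for all \<open>v\<close>.

  If \<open>T\<close> has a Jordan block of size at least two, there are \<open>v \<noteq> 0\<close> and \<open>w\<close> with \<open>T v = a v\<close> and
  \<open>T w = a w + v\<close>, and \<open>D\<^sub>v D\<^sub>w g = D\<^sub>w D\<^sub>v g\<close> becomes \<open>D\<^sub>v D\<^sub>v f = 0\<close>. In coordinates in which \<open>v\<close> is a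
  unit vector, \<open>f = x\<^sub>k A + C\<close> with \<open>A\<close> and \<open>C\<close> free of \<open>x\<^sub>k\<close>: either \<open>A = 0\<close> and \<open>f\<close> is a cone, or the
  point \<open>v\<close> has multiplicity exactly \<open>d - 1\<close>.

  Otherwise there is a basis of eigenvectors \<open>v\<^sub>i\<close> with eigenvalues \<open>\<mu>\<^sub>i\<close>, and symmetry of the second
  derivatives of \<open>g\<close> along \<open>v\<^sub>i\<close> and \<open>v\<^sub>j\<close> gives \<open>(\<mu>\<^sub>i - \<mu>\<^sub>j) D\<^sub>i D\<^sub>j f = 0\<close>. The eigenvalues are not
  all equal because \<open>g\<close> is not a multiple of \<open>f\<close>, so separating the coordinates by eigenvalue splits \<open>f\<close>.
\<close>

abbreviation coef :: "cpoly \<Rightarrow> (nat \<Rightarrow>\<^sub>0 nat) \<Rightarrow> complex" where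
  "coef \<equiv> Poly_Mapping.lookup"

abbreviation mons :: "cpoly \<Rightarrow> (nat \<Rightarrow>\<^sub>0 nat) set" where
  "mons \<equiv> Poly_Mapping.keys"

abbreviation polys :: "nat set \<Rightarrow> cpoly set" where
  "polys V \<equiv> carrier (polyring V)"

section \<open>Polynomials and substitution\<close>

lemma polys_iff: "p \<in> polys V \<longleftrightarrow> (\<forall>m\<in>mons p. Poly_Mapping.keys m \<subseteq> V)"
  by (simp add: polyring_def)

lemma sum_monomials: "(\<Sum>m\<in>Poly_Mapping.keys p. Poly_Mapping.single m (Poly_Mapping.lookup p m)) = p"
  for p :: "'a \<Rightarrow>\<^sub>0 'b::comm_monoid_add"
proof (rule poly_mapping_eqI)
  fix k
  show "Poly_Mapping.lookup (\<Sum>m\<in>Poly_Mapping.keys p. Poly_Mapping.single m (Poly_Mapping.lookup p m)) k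
      = Poly_Mapping.lookup p k"
    by (cases "k \<in> Poly_Mapping.keys p")
      (auto simp: lookup_sum lookup_single when_def sum.delta in_keys_iff)
qed

text \<open>The single case only concerns monomials occurring in \<open>p\<close>, with their
  coefficients in \<open>p\<close>, so hypotheses on the support of \<open>p\<close> stay
  usable.\<close>

lemma poly_mapping_sum_induct [case_names zero single add]:
  fixes p :: "'a \<Rightarrow>\<^sub>0 'b::comm_monoid_add"
  assumes "P 0" and "\<And>m. m \<in> Poly_Mapping.keys p \<Longrightarrow> P (Poly_Mapping.single m (Poly_Mapping.lookup p m))"
    and "\<And>p q. P p \<Longrightarrow> P q \<Longrightarrow> P (p + q)"
  shows "P p"
proof -
  have "P (\<Sum>m\<in>M. Poly_Mapping.single m (Poly_Mapping.lookup p m))"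
    if "finite M" "M \<subseteq> Poly_Mapping.keys p" for M
    using that by (induction M rule: finite_induct) (auto intro: assms)
  from this[of "Poly_Mapping.keys p"] show ?thesis by (simp add: sum_monomials)
qed

lemma minus_single_add:
  fixes m :: "'a \<Rightarrow>\<^sub>0 nat"
  assumes "i \<in> Poly_Mapping.keys m"
  shows "m - Poly_Mapping.single i 1 + Poly_Mapping.single i 1 = m"
proof (rule poly_mapping_eqI)
  fix k
  show "Poly_Mapping.lookup (m - Poly_Mapping.single i 1 + Poly_Mapping.single i 1) k
      = Poly_Mapping.lookup m k"
    using assms
    by (cases "k = i") (simp_all add: lookup_add lookup_minus lookup_single_not_eq in_keys_iff)
qed

section \<open>Values and degrees of monomials\<close>

definition mon_value :: "(nat \<Rightarrow> 'a::comm_monoid_mult) \<Rightarrow> (nat \<Rightarrow>\<^sub>0 nat) \<Rightarrow> 'a" where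
  "mon_value y m = (\<Prod>i\<in>Poly_Mapping.keys m. y i ^ Poly_Mapping.lookup m i)"

lemma mon_value_superset:
  assumes "finite S" "Poly_Mapping.keys m \<subseteq> S"
  shows "mon_value y m = (\<Prod>i\<in>S. y i ^ Poly_Mapping.lookup m i)"
  unfolding mon_value_def using assms
  by (intro prod.mono_neutral_left) (auto simp: in_keys_iff)

lemma mon_value_add: "mon_value y (m + m') = mon_value y m * mon_value y m'"
proof -
  let ?S = "Poly_Mapping.keys m \<union> Poly_Mapping.keys m'"
  have "mon_value y (m + m') = (\<Prod>i\<in>?S. y i ^ Poly_Mapping.lookup (m + m') i)"
    by (rule mon_value_superset) (auto simp: keys_add)
  then show ?thesis
    by (simp add: mon_value_superset[of ?S m] mon_value_superset[of ?S m'] lookup_add power_add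
        prod.distrib)
qed

lemma mon_value_zero [simp]: "mon_value y 0 = 1"
  by (simp add: mon_value_def)

lemma mon_value_single [simp]: "mon_value y (Poly_Mapping.single i k) = y i ^ k"
  by (cases "k = 0") (auto simp: mon_value_def)

lemma mon_degree_superset:
  assumes "finite S" "Poly_Mapping.keys m \<subseteq> S"
  shows "mon_degree m = (\<Sum>i\<in>S. Poly_Mapping.lookup m i)"
  unfolding mon_degree_def using assms
  by (intro sum.mono_neutral_left) (auto simp: in_keys_iff)

lemma mon_degree_add: "mon_degree (m + m') = mon_degree m + mon_degree m'"
proof -
  let ?S = "Poly_Mapping.keys m \<union> Poly_Mapping.keys m'"
  have "mon_degree (m + m') = (\<Sum>i\<in>?S. Poly_Mapping.lookup (m + m') i)"
    by (rule mon_degree_superset) (auto simp: keys_add)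
  then show ?thesis
    by (simp add: mon_degree_superset[of ?S m] mon_degree_superset[of ?S m'] lookup_add sum.distrib)
qed

lemma mon_degree_zero [simp]: "mon_degree 0 = 0"
  by (simp add: mon_degree_def)

lemma mon_degree_single [simp]: "mon_degree (Poly_Mapping.single i k) = k"
  by (cases "k = 0") (auto simp: mon_degree_def)

lemma mon_degree_eq_0_iff [simp]: "mon_degree m = 0 \<longleftrightarrow> m = 0"
  by (auto simp: mon_degree_def in_keys_iff intro!: poly_mapping_eqI)

section \<open>Constant polynomials\<close>

lemma Const_0 [simp]: "Const 0 = 0"
  and Const_1 [simp]: "Const 1 = 1"
  and Const_add: "Const (a + b) = Const a + Const b"
  and Const_mult: "Const (a * b) = Const a * Const b"
  and Const_uminus: "Const (- a) = - Const a"
  and Const_diff: "Const (a - b) = Const a - Const b"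
  by (simp_all add: Const_def single_add mult_single single_uminus single_diff)

lemma Const_sum: "Const (\<Sum>i\<in>S. h i) = (\<Sum>i\<in>S. Const (h i))"
  by (induction S rule: infinite_finite_induct) (auto simp: Const_add)

lemma Const_prod: "Const (\<Prod>i\<in>S. h i) = (\<Prod>i\<in>S. Const (h i))"
  by (induction S rule: infinite_finite_induct) (auto simp: Const_mult)

lemma Const_power: "Const (a ^ k) = Const a ^ k"
  by (induction k) (auto simp: Const_mult)

lemma Const_eq_iff [simp]: "Const a = Const b \<longleftrightarrow> a = b"
  by (metis Const_def lookup_single_eq)

lemma Const_eq_0_iff [simp]: "Const a = 0 \<longleftrightarrow> a = 0"
  using Const_eq_iff[of a 0] by (simp del: Const_eq_iff)

lemma coef_Const_mult [simp]: "coef (Const c * p) m = c * coef p m"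
proof (induction p rule: poly_mapping_sum_induct)
  case (single m)
  then show ?case by (auto simp: Const_def mult_single lookup_single when_def)
qed (auto simp: lookup_add algebra_simps)

section \<open>Substitution as a ring homomorphism\<close>

lemma substitute_superset:
  assumes "finite S" "mons f \<subseteq> S"
  shows "substitute y f = (\<Sum>m\<in>S. Const (coef f m) * mon_value y m)"
  unfolding substitute_def mon_value_def[symmetric] using assms
  by (intro sum.mono_neutral_left) (auto simp: in_keys_iff)

lemma substitute_0 [simp]: "substitute y 0 = 0"
  by (simp add: substitute_def)

lemma substitute_single: "substitute y (Poly_Mapping.single m c) = Const c * mon_value y m"
  by (cases "c = 0") (auto simp: substitute_def mon_value_def)

lemma substitute_add: "substitute y (f + g) = substitute y f + substitute y g"
proof -
  let ?S = "mons f \<union> mons g"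
  have "substitute y (f + g) = (\<Sum>m\<in>?S. Const (coef (f + g) m) * mon_value y m)"
    by (rule substitute_superset) (auto simp: keys_add)
  then show ?thesis
    by (simp add: substitute_superset[of ?S f] substitute_superset[of ?S g] lookup_add Const_add
        algebra_simps sum.distrib)
qed

lemma substitute_sum: "substitute y (\<Sum>i\<in>S. h i) = (\<Sum>i\<in>S. substitute y (h i))"
  by (induction S rule: infinite_finite_induct) (auto simp: substitute_add)

lemma substitute_mult: "substitute y (f * g) = substitute y f * substitute y g"
proof (induction f rule: poly_mapping_sum_induct)
  case f: (single m)
  show ?case
  proof (induction g rule: poly_mapping_sum_induct)
    case (single m')
    show ?case
      by (simp add: mult_single substitute_single Const_mult mon_value_add algebra_simps)
  qed (auto simp: substitute_add algebra_simps)
qed (auto simp: substitute_add algebra_simps)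

lemma substitute_Const [simp]: "substitute y (Const c) = Const c"
  by (simp add: Const_def substitute_single)

lemma substitute_1 [simp]: "substitute y 1 = 1"
  using substitute_Const[of y 1] by simp

lemma substitute_uminus: "substitute y (- f) = - substitute y f"
  using substitute_add[of y f "- f"] by (simp add: eq_neg_iff_add_eq_0 add.commute)

lemma substitute_diff: "substitute y (f - g) = substitute y f - substitute y g"
  using substitute_add[of y f "- g"] by (simp add: substitute_uminus)

lemma substitute_Var [simp]: "substitute y (Var i) = y i"
  by (simp add: Var_def substitute_single)

lemma substitute_power: "substitute y (f ^ k) = substitute y f ^ k"
  by (induction k) (auto simp: substitute_mult)

lemma substitute_prod: "substitute y (\<Prod>i\<in>S. h i) = (\<Prod>i\<in>S. substitute y (h i))"
  by (induction S rule: infinite_finite_induct) (auto simp: substitute_mult)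

lemma substitute_mon_value: "substitute y (mon_value z m) = mon_value (\<lambda>i. substitute y (z i)) m"
  by (simp add: mon_value_def substitute_prod substitute_power)

lemma substitute_substitute:
  "substitute y (substitute z f) = substitute (\<lambda>i. substitute y (z i)) f"
  by (induction f rule: poly_mapping_sum_induct)
    (auto simp: substitute_single substitute_add substitute_mult substitute_mon_value)

lemma mon_value_Var: "mon_value Var m = Poly_Mapping.single m 1"
proof (induction m rule: poly_mapping_sum_induct)
  case (single i)
  show ?case
  proof (induction "Poly_Mapping.lookup m i")
    case (Suc k)
    have "mon_value Var (Poly_Mapping.single i k) = Poly_Mapping.single (Poly_Mapping.single i k) 1" for k
    proof (induction k)
      case (Suc k)
      then show ?case
        by (simp add: Var_def mult_single flip: single_add)
    qed simp
    then show ?case .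
  qed simp
qed (auto simp: mon_value_add mult_single)

lemma substitute_Var_id [simp]: "substitute Var f = f"
  by (induction f rule: poly_mapping_sum_induct)
    (auto simp: substitute_single substitute_add mon_value_Var Const_def mult_single)

lemma substitute_cong:
  assumes "f \<in> polys V" "\<And>i. i \<in> V \<Longrightarrow> y i = z i"
  shows "substitute y f = substitute z f"
  unfolding substitute_def
proof (intro sum.cong refl arg_cong2[of _ _ _ _ "(*)"] prod.cong)
  fix m i assume "m \<in> mons f" "i \<in> Poly_Mapping.keys m"
  then have "i \<in> V" using assms by (auto simp: polys_iff)
  then show "y i ^ Poly_Mapping.lookup m i = z i ^ Poly_Mapping.lookup m i"
    using assms by simp
qed

text \<open>Evaluation is substitution of constants, so the injectivity of \<open>Const\<close>
  transfers the laws of \<open>substitute\<close> to \<open>eval_at\<close>.\<close>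

lemma Const_eval_at: "Const (eval_at a f) = substitute (\<lambda>i. Const (a i)) f"
  by (simp add: eval_at_def substitute_def Const_sum Const_mult Const_prod Const_power)

lemma eval_at_add: "eval_at a (f + g) = eval_at a f + eval_at a g"
  and eval_at_mult: "eval_at a (f * g) = eval_at a f * eval_at a g"
  by (rule Const_eq_iff[THEN iffD1],
      simp only: Const_eval_at Const_add Const_mult substitute_add substitute_mult)+

lemma eval_at_Const [simp]: "eval_at a (Const c) = c"
  and eval_at_Var [simp]: "eval_at a (Var i) = a i"
  by (rule Const_eq_iff[THEN iffD1], simp add: Const_eval_at)+

lemma eval_at_1 [simp]: "eval_at a 1 = 1"
  using eval_at_Const[of a 1] by simp

lemma eval_at_0 [simp]: "eval_at a 0 = 0"
  using eval_at_Const[of a 0] by simp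

lemma eval_at_substitute: "eval_at a (substitute y f) = eval_at (\<lambda>i. eval_at a (y i)) f"
  by (rule Const_eq_iff[THEN iffD1]) (simp add: Const_eval_at substitute_substitute)

section \<open>Membership in the polynomial ring on a set of variables\<close>

lemma Const_in_polys [simp]: "Const c \<in> polys V"
  by (auto simp: polys_iff Const_def split: if_splits)

lemma zero_in_polys [simp]: "0 \<in> polys V" and one_in_polys [simp]: "1 \<in> polys V"
  using Const_in_polys[of 0] Const_in_polys[of 1] by simp_all

lemma Var_in_polys: "i \<in> V \<Longrightarrow> Var i \<in> polys V"
  by (auto simp: polys_iff Var_def)

lemma add_in_polys: "f \<in> polys V \<Longrightarrow> g \<in> polys V \<Longrightarrow> f + g \<in> polys V"
  unfolding polys_iff using keys_add[of f g] by blast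

lemma mult_in_polys:
  assumes "f \<in> polys V" "g \<in> polys V"
  shows "f * g \<in> polys V"
  unfolding polys_iff
proof
  fix m assume "m \<in> mons (f * g)"
  then obtain a b where m: "m = a + b" "a \<in> mons f" "b \<in> mons g"
    using keys_mult[of f g] by blast
  then have "Poly_Mapping.keys a \<subseteq> V" "Poly_Mapping.keys b \<subseteq> V"
    using assms by (auto simp: polys_iff)
  then show "Poly_Mapping.keys m \<subseteq> V" using keys_add[of a b] m(1) by auto
qed

lemma uminus_in_polys: "f \<in> polys V \<Longrightarrow> - f \<in> polys V"
  by (auto simp: polys_iff)

lemma diff_in_polys: "f \<in> polys V \<Longrightarrow> g \<in> polys V \<Longrightarrow> f - g \<in> polys V"
  using add_in_polys[OF _ uminus_in_polys, of f V g] by simp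

lemma power_in_polys: "f \<in> polys V \<Longrightarrow> f ^ k \<in> polys V"
  by (induction k) (auto simp: mult_in_polys)

lemma prod_in_polys: "(\<And>i. i \<in> S \<Longrightarrow> h i \<in> polys V) \<Longrightarrow> (\<Prod>i\<in>S. h i) \<in> polys V"
  by (induction S rule: infinite_finite_induct) (auto simp: mult_in_polys)

text \<open>The identity \<open>substitute Var f = f\<close> writes \<open>f\<close> as a finite sum
  of constants times products of variables from \<open>V\<close>.\<close>

lemma polys_induct [consumes 1, case_names Const Var add mult]:
  assumes "f \<in> polys V" "\<And>c. P (Const c)" "\<And>i. i \<in> V \<Longrightarrow> P (Var i)"
    "\<And>f g. P f \<Longrightarrow> P g \<Longrightarrow> P (f + g)" "\<And>f g. P f \<Longrightarrow> P g \<Longrightarrow> P (f * g)"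
  shows "P f"
proof -
  have pow: "P (Var i ^ k)" if "i \<in> V" for i k
    using assms(2)[of 1] assms that by (induction k) auto
  have mon: "P (\<Prod>i\<in>I. Var i ^ e i)" if "finite I" "I \<subseteq> V" for I e
    using that by (induction I rule: finite_induct) (use assms(2)[of 1] assms pow in auto)
  have "P (substitute Var f)"
    unfolding substitute_def
  proof -
    have "P (\<Sum>m\<in>M. Const (coef f m) * (\<Prod>i\<in>Poly_Mapping.keys m. Var i ^ Poly_Mapping.lookup m i))"
      if "finite M" "M \<subseteq> mons f" for M
      using that
      by (induction M rule: finite_induct)
        (use assms(1,2) assms(2)[of 0] mon in \<open>auto intro!: assms(4,5) simp: polys_iff\<close>)
    then show "P (\<Sum>m\<in>mons f. Const (coef f m) * (\<Prod>i\<in>Poly_Mapping.keys m. Var i ^ Poly_Mapping.lookup m i))"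
      by simp
  qed
  then show ?thesis by simp
qed

section \<open>Forms\<close>

lemma form_0 [simp]: "form V d 0"
  by (simp add: form_def)

lemma form_polys: "form V d f \<Longrightarrow> f \<in> polys V"
  by (simp add: form_def)

lemma form_Const: "form V 0 (Const c)"
  unfolding form_def by (intro conjI Const_in_polys) (simp add: Const_def)

lemma form_Var: "i \<in> V \<Longrightarrow> form V 1 (Var i)"
  by (auto simp: form_def Var_in_polys) (auto simp: Var_def)

lemma form_add: "form V d f \<Longrightarrow> form V d g \<Longrightarrow> form V d (f + g)"
  unfolding form_def using keys_add[of f g] add_in_polys[of f V g] by blast

lemma form_uminus: "form V d f \<Longrightarrow> form V d (- f)"
  by (auto simp: form_def uminus_in_polys)

lemma form_diff: "form V d f \<Longrightarrow> form V d g \<Longrightarrow> form V d (f - g)"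
  using form_add[OF _ form_uminus, of V d f g] by simp

lemma form_sum: "(\<And>i. i \<in> S \<Longrightarrow> form V d (h i)) \<Longrightarrow> form V d (\<Sum>i\<in>S. h i)"
  by (induction S rule: infinite_finite_induct) (auto intro: form_add)

lemma form_mult:
  assumes "form V d f" "form V e g"
  shows "form V (d + e) (f * g)"
  unfolding form_def
proof (intro conjI ballI)
  fix m assume "m \<in> mons (f * g)"
  then obtain a b where "m = a + b" "a \<in> mons f" "b \<in> mons g" using keys_mult[of f g] by blast
  then show "mon_degree m = d + e" using assms by (auto simp: form_def mon_degree_add)
qed (use assms in \<open>auto simp: form_def intro: mult_in_polys\<close>)

lemma form_Const_mult: "form V d f \<Longrightarrow> form V d (Const c * f)"
  using form_mult[OF form_Const] by fastforce

lemma form_1: "form V 0 1"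
  using form_Const[of V 1] by simp

lemma form_power: "form V d f \<Longrightarrow> form V (d * k) (f ^ k)"
  by (induction k) (auto intro: form_mult form_1)

lemma form_prod:
  "(\<And>i. i \<in> S \<Longrightarrow> form V (e i) (h i)) \<Longrightarrow> form V (\<Sum>i\<in>S. e i) (\<Prod>i\<in>S. h i)"
  by (induction S rule: infinite_finite_induct) (auto intro: form_mult form_1)

lemma form_substitute:
  assumes f: "form V d f" and y: "\<And>i. i \<in> V \<Longrightarrow> form W 1 (y i)"
  shows "form W d (substitute y f)"
  unfolding substitute_def
proof (intro form_sum form_Const_mult)
  fix m assume m: "m \<in> mons f"
  have "form W (\<Sum>i\<in>Poly_Mapping.keys m. 1 * Poly_Mapping.lookup m i)
      (\<Prod>i\<in>Poly_Mapping.keys m. y i ^ Poly_Mapping.lookup m i)"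
    using f m by (intro form_prod form_power y) (auto simp: form_def polys_iff)
  then show "form W d (\<Prod>i\<in>Poly_Mapping.keys m. y i ^ Poly_Mapping.lookup m i)"
    using f m by (auto simp: form_def mon_degree_def)
qed

lemma coef_form: "form V d f \<Longrightarrow> mon_degree m \<noteq> d \<Longrightarrow> coef f m = 0"
  by (auto simp: form_def in_keys_iff)

section \<open>Derivatives and linear changes of coordinates\<close>

text \<open>Among the monomials containing \<open>x_i\<close>, only one is lowered to
  \<open>m\<close>; the monomials free of \<open>x_i\<close> carry the factor zero.\<close>

lemma coef_partial_deriv:
  "coef (partial_deriv i f) m
     = of_nat (Suc (Poly_Mapping.lookup m i)) * coef f (m + Poly_Mapping.single i 1)"
proof -
  let ?e = "Poly_Mapping.single i (1::nat)"
  have "coef (partial_deriv i f) m = (\<Sum>m'\<in>mons f. if m' = m + ?e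
      then of_nat (Poly_Mapping.lookup m' i) * coef f m' else 0)"
    unfolding partial_deriv_def lookup_sum
  proof (rule sum.cong[OF refl])
    fix m' assume "m' \<in> mons f"
    have "m' = m + ?e" if "m' - ?e = m" "Poly_Mapping.lookup m' i \<noteq> 0"
    proof (rule poly_mapping_eqI)
      fix k
      show "Poly_Mapping.lookup m' k = Poly_Mapping.lookup (m + ?e) k"
        using that(2) unfolding that(1)[symmetric]
        by (cases "k = i") (simp_all add: lookup_add lookup_minus lookup_single_not_eq)
    qed
    then have "m' - ?e \<noteq> m \<or> Poly_Mapping.lookup m' i = 0" if "m' \<noteq> m + ?e"
      using that by blast
    then show "coef (Poly_Mapping.single (m' - ?e)
        (of_nat (Poly_Mapping.lookup m' i) * coef f m')) m
      = (if m' = m + ?e then of_nat (Poly_Mapping.lookup m' i) * coef f m' else 0)"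
      by (cases "m' = m + ?e") (auto simp: lookup_single_not_eq)
  qed
  then show ?thesis
    by (cases "m + ?e \<in> mons f") (auto simp: sum.delta in_keys_iff lookup_add)
qed

lemma partial_deriv_0 [simp]: "partial_deriv i 0 = 0"
  by (simp add: partial_deriv_def)

lemma partial_deriv_add: "partial_deriv i (f + g) = partial_deriv i f + partial_deriv i g"
  by (rule poly_mapping_eqI) (simp add: coef_partial_deriv lookup_add algebra_simps)

lemma partial_deriv_Const_mult: "partial_deriv i (Const c * f) = Const c * partial_deriv i f"
  by (rule poly_mapping_eqI) (simp add: coef_partial_deriv)

lemma partial_deriv_sum: "partial_deriv i (\<Sum>j\<in>S. h j) = (\<Sum>j\<in>S. partial_deriv i (h j))"
  by (induction S rule: infinite_finite_induct) (auto simp: partial_deriv_add)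

lemma partial_deriv_single:
  "partial_deriv i (Poly_Mapping.single m c)
     = Poly_Mapping.single (m - Poly_Mapping.single i 1) (of_nat (Poly_Mapping.lookup m i) * c)"
  by (cases "c = 0") (simp_all add: partial_deriv_def)

lemma partial_deriv_Const [simp]: "partial_deriv i (Const c) = 0"
  by (simp add: Const_def partial_deriv_single)

lemma partial_deriv_Var: "partial_deriv i (Var j) = (if i = j then 1 else 0)"
  by (simp add: Var_def partial_deriv_single lookup_single)

lemma partial_deriv_commute:
  "partial_deriv i (partial_deriv j f) = partial_deriv j (partial_deriv i f)"
  by (cases "i = j")
    (auto intro!: poly_mapping_eqI simp: coef_partial_deriv lookup_add lookup_single add_ac)

lemma partial_deriv_mult:
  "partial_deriv i (f * g) = partial_deriv i f * g + f * partial_deriv i g"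
proof (induction f rule: poly_mapping_sum_induct)
  case f: (single m)
  show ?case
  proof (induction g rule: poly_mapping_sum_induct)
    case (single m')
    let ?e = "Poly_Mapping.single i (1::nat)"
    \<comment> \<open>Truncated subtraction is safe once \<open>x_i\<close> occurs in
      \<open>a\<close>; otherwise the derivative of that factor is zero.\<close>
    have *: "a - ?e + b = a + b - ?e" if "Poly_Mapping.lookup a i \<noteq> 0" for a b
    proof (rule poly_mapping_eqI)
      fix k
      show "Poly_Mapping.lookup (a - ?e + b) k = Poly_Mapping.lookup (a + b - ?e) k"
        using that by (cases "k = i") (simp_all add: lookup_add lookup_minus lookup_single_not_eq)
    qed
    show ?case
      using *[of m m'] *[of m' m]
      by (cases "Poly_Mapping.lookup m i = 0"; cases "Poly_Mapping.lookup m' i = 0")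
        (simp_all add: partial_deriv_single mult_single lookup_add add.commute
          algebra_simps flip: single_add)
  qed (auto simp: partial_deriv_add algebra_simps)
qed (auto simp: partial_deriv_add algebra_simps)

lemma form_partial_deriv:
  assumes "form V d f"
  shows "form V (d - 1) (partial_deriv i f)"
  unfolding form_def polys_iff
proof (intro conjI ballI)
  fix m assume "m \<in> mons (partial_deriv i f)"
  then have "m + Poly_Mapping.single i 1 \<in> mons f"
    by (auto simp: in_keys_iff coef_partial_deriv)
  then have "mon_degree (m + Poly_Mapping.single i 1) = d"
    and V: "Poly_Mapping.keys (m + Poly_Mapping.single i 1) \<subseteq> V"
    using assms by (auto simp: form_def polys_iff)
  then show "mon_degree m = d - 1" by (simp add: mon_degree_add)
  show "Poly_Mapping.keys m \<subseteq> V"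
    using V by (force simp: in_keys_iff lookup_add)
qed

text \<open>By induction on the construction of \<open>f\<close>: both sides are additive in
  \<open>f\<close> and obey the same product rule.\<close>

lemma chain_rule:
  assumes "f \<in> polys V" "finite V"
  shows "partial_deriv k (substitute y f)
    = (\<Sum>j\<in>V. substitute y (partial_deriv j f) * partial_deriv k (y j))"
  using assms(1)
proof (induction f rule: polys_induct)
  case (Var i)
  have "(\<Sum>j\<in>V. substitute y (partial_deriv j (Var i)) * partial_deriv k (y j))
      = (\<Sum>j\<in>V. if j = i then partial_deriv k (y j) else 0)"
    by (rule sum.cong) (auto simp: partial_deriv_Var)
  then show ?case using Var assms(2) by (simp add: sum.delta)
next
  case (add f g)
  then show ?case
    by (simp add: substitute_add partial_deriv_add algebra_simps sum.distrib)
next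
  case (mult f g)
  then show ?case
    by (simp add: substitute_mult substitute_add partial_deriv_mult algebra_simps sum.distrib
        sum_distrib_left)
qed simp

section \<open>Directional derivatives\<close>

definition dir_deriv :: "nat \<Rightarrow> (nat \<Rightarrow> complex) \<Rightarrow> cpoly \<Rightarrow> cpoly" where
  "dir_deriv n v f = (\<Sum>i\<le>n. Const (v i) * partial_deriv i f)"

lemma dir_deriv_0 [simp]: "dir_deriv n v 0 = 0"
  by (simp add: dir_deriv_def)

lemma dir_deriv_add: "dir_deriv n v (f + g) = dir_deriv n v f + dir_deriv n v g"
  by (simp add: dir_deriv_def partial_deriv_add algebra_simps sum.distrib)

lemma dir_deriv_Const_mult: "dir_deriv n v (Const c * f) = Const c * dir_deriv n v f"
  by (simp add: dir_deriv_def partial_deriv_Const_mult sum_distrib_left mult.left_commute)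

lemma dir_deriv_scale: "dir_deriv n (\<lambda>i. c * v i) f = Const c * dir_deriv n v f"
  by (simp add: dir_deriv_def Const_mult sum_distrib_left mult.assoc)

lemma dir_deriv_commute: "dir_deriv n v (dir_deriv n w f) = dir_deriv n w (dir_deriv n v f)"
proof -
  have expand: "dir_deriv n v (dir_deriv n w f)
      = (\<Sum>i\<le>n. \<Sum>j\<le>n. Const (v i) * (Const (w j) * partial_deriv i (partial_deriv j f)))" for v w
    by (simp add: dir_deriv_def partial_deriv_sum partial_deriv_Const_mult sum_distrib_left)
  show ?thesis
    unfolding expand by (subst sum.swap) (simp add: partial_deriv_commute mult.left_commute)
qed

text \<open>The counterpart of \<open>linear_coordinate\<close> for a matrix given as a function of
  two indices, free of dimension conditions.\<close>

definition lin :: "nat \<Rightarrow> (nat \<Rightarrow> nat \<Rightarrow> complex) \<Rightarrow> nat \<Rightarrow> cpoly" where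
  "lin n P i = (\<Sum>j\<le>n. Const (P i j) * Var j)"

lemma form_lin: "form {..n} 1 (lin n P i)"
  unfolding lin_def by (intro form_sum form_Const_mult form_Var) auto

lemma lin_unit: "i \<le> n \<Longrightarrow> lin n (\<lambda>i j. if i = j then 1 else 0) i = Var i"
  unfolding lin_def
  by (subst sum.cong[OF refl, where h = "\<lambda>j. if j = i then Var i else 0"]) auto

lemma partial_deriv_lin: "k \<le> n \<Longrightarrow> partial_deriv k (lin n P i) = Const (P i k)"
proof -
  assume "k \<le> n"
  have "partial_deriv k (lin n P i) = (\<Sum>j\<le>n. Const (P i j) * (if k = j then 1 else 0))"
    by (simp add: lin_def partial_deriv_sum partial_deriv_Const_mult partial_deriv_Var)
  also have "\<dots> = (\<Sum>j\<le>n. if j = k then Const (P i k) else 0)"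
    by (rule sum.cong) auto
  finally show ?thesis using \<open>k \<le> n\<close> by (simp add: sum.delta)
qed

text \<open>Column \<open>k\<close> of \<open>P\<close> is the image of the \<open>k\<close>-th unit
  vector, so by the chain rule the new partial derivative is the old derivative along that
  column.\<close>

lemma partial_deriv_substitute_lin:
  assumes "f \<in> polys {..n}" "k \<le> n"
  shows "partial_deriv k (substitute (lin n P) f) = substitute (lin n P) (dir_deriv n (\<lambda>i. P i k) f)"
  using assms
  by (simp add: chain_rule[of f "{..n}"] partial_deriv_lin dir_deriv_def substitute_sum
      substitute_mult mult.commute)

lemma form_dir_deriv: "form V d f \<Longrightarrow> form V (d - 1) (dir_deriv n v f)"
  unfolding dir_deriv_def by (intro form_sum form_Const_mult form_partial_deriv)

definition right_inverse :: "nat \<Rightarrow> (nat \<Rightarrow> nat \<Rightarrow> complex) \<Rightarrow> (nat \<Rightarrow> nat \<Rightarrow> complex) \<Rightarrow> bool" where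
  "right_inverse n P Q \<longleftrightarrow>
     (\<forall>i\<le>n. \<forall>j\<le>n. (\<Sum>k\<le>n. P i k * Q k j) = (if i = j then 1 else 0))"

text \<open>The matrices multiply in the order \<open>P Q\<close>, since the outer substitution acts
  on the variables inside the forms given by \<open>P\<close>.\<close>

lemma substitute_lin_lin:
  "substitute (lin n Q) (lin n P i) = lin n (\<lambda>i j. \<Sum>k\<le>n. P i k * Q k j) i"
proof -
  have "substitute (lin n Q) (lin n P i) = (\<Sum>k\<le>n. \<Sum>j\<le>n. Const (P i k * Q k j) * Var j)"
    by (simp add: lin_def[of n P] substitute_sum substitute_mult lin_def sum_distrib_left Const_mult
        mult.assoc)
  then show ?thesis
    by (subst (asm) sum.swap) (simp add: lin_def Const_sum sum_distrib_right)
qed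

lemma substitute_lin_inverse:
  assumes "f \<in> polys {..n}" "right_inverse n P Q"
  shows "substitute (lin n Q) (substitute (lin n P) f) = f"
proof -
  have "substitute (lin n Q) (lin n P i) = Var i" if "i \<le> n" for i
  proof -
    have "substitute (lin n Q) (lin n P i) = lin n (\<lambda>i j. if i = j then 1 else 0) i"
      unfolding substitute_lin_lin unfolding lin_def using assms(2) that
      by (intro sum.cong refl) (simp add: right_inverse_def)
    then show ?thesis using that by (simp add: lin_unit)
  qed
  then have "substitute (\<lambda>i. substitute (lin n Q) (lin n P i)) f = substitute Var f"
    using assms(1) by (intro substitute_cong[of f "{..n}"]) auto
  then show ?thesis by (simp add: substitute_substitute)
qed

section \<open>Equality of Jacobian ideals\<close>

lemma polyring_simps [simp]:
  "x \<oplus>\<^bsub>polyring V\<^esub> y = x + y" "x \<otimes>\<^bsub>polyring V\<^esub> y = x * y"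
  "\<zero>\<^bsub>polyring V\<^esub> = 0" "\<one>\<^bsub>polyring V\<^esub> = 1"
  by (simp_all add: polyring_def)

lemma ring_polyring: "ring (polyring V)"
proof (rule ringI)
  show "abelian_group (polyring V)"
  proof (rule abelian_groupI)
    show "\<exists>y\<in>polys V. y \<oplus>\<^bsub>polyring V\<^esub> x = \<zero>\<^bsub>polyring V\<^esub>" if "x \<in> polys V" for x
      using uminus_in_polys[OF that] by (intro bexI[of _ "- x"]) simp_all
  qed (simp_all add: add_in_polys add_ac)
  show "monoid (polyring V)"
    by (rule monoidI) (simp_all add: mult_in_polys mult_ac)
qed (simp_all add: algebra_simps)

text \<open>A nonconstant monomial raises degrees strictly, so its product with \<open>p\<close> has
  nothing left in degree at most \<open>d\<close>.\<close>

lemma coef_single_mult_low: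
  assumes low: "\<And>m. mon_degree m < d \<Longrightarrow> coef p m = 0"
    and m: "mon_degree m \<le> d"
  shows "coef (Poly_Mapping.single a c * p) m = (if a = 0 then c * coef p m else 0)"
proof (cases "a = 0")
  case True
  then show ?thesis using coef_Const_mult[of c p m] by (simp add: Const_def)
next
  case False
  have "coef (Poly_Mapping.single a c * p) m = 0"
  proof (rule ccontr)
    assume "coef (Poly_Mapping.single a c * p) m \<noteq> 0"
    then have "m \<in> mons (Poly_Mapping.single a c * p)" by (simp add: in_keys_iff)
    then obtain b where "m = a + b" "b \<in> mons p"
      using keys_mult[of "Poly_Mapping.single a c" p] by (auto split: if_splits)
    moreover have "0 < mon_degree a"
      using False by (metis mon_degree_eq_0_iff neq0_conv)
    ultimately have "mon_degree b < d" using m by (simp only: mon_degree_add)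
    then show False using low[of b] \<open>b \<in> mons p\<close> by (simp add: in_keys_iff)
  qed
  then show ?thesis using False by simp
qed

lemma coef_mult_low:
  assumes low: "\<And>m. mon_degree m < d \<Longrightarrow> coef p m = 0"
    and m: "mon_degree m \<le> d"
  shows "coef (r * p) m = coef r 0 * coef p m"
proof (induction r rule: poly_mapping_sum_induct)
  case (single a)
  show ?case
    using coef_single_mult_low[OF low m, of a] by (simp add: lookup_single when_def)
qed (simp_all add: lookup_add algebra_simps)

text \<open>Multiplication by \<open>r\<close> multiplies the component of lowest degree by the constant term of \<open>r\<close>.\<close>

lemma jacobian_ideal_low:
  assumes f: "form {..n} d f" and p: "p \<in> jacobian_ideal n f"
  shows "\<exists>c. \<forall>m. mon_degree m \<le> d - 1 \<longrightarrow> coef p m = coef (\<Sum>j\<le>n. Const (c j) * partial_deriv j f) m"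
proof -
  interpret R: ring "polyring {..n}" by (rule ring_polyring)
  define L where "L c = (\<Sum>j\<le>n. Const (c j) * partial_deriv j f)" for c :: "nat \<Rightarrow> complex"
  \<comment> \<open>In \<open>I\<close> the part of degree at most \<open>d - 1\<close> must be a
    constant combination of the partial derivatives. This is an ideal containing the generators,
    hence the whole Jacobian ideal.\<close>
  define I where "I = {p \<in> polys {..n}. \<exists>c. \<forall>m. mon_degree m \<le> d - 1 \<longrightarrow> coef p m = coef (L c) m}"
  have L_form: "form {..n} (d - 1) (L c)" for c
    unfolding L_def by (intro form_sum form_Const_mult form_partial_deriv f)
  have L_add: "L c + L c' = L (\<lambda>j. c j + c' j)" for c c'
    by (simp add: L_def Const_add algebra_simps sum.distrib)
  have L_scale: "Const a * L c = L (\<lambda>j. a * c j)" for a c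
    by (simp add: L_def Const_mult sum_distrib_left mult.assoc)
  have minus: "\<ominus>\<^bsub>polyring {..n}\<^esub> x = - x" if "x \<in> polys {..n}" for x
    using that uminus_in_polys[OF that]
    by (intro R.minus_equality) simp_all
  have mult_I: "r * x \<in> I" if x: "x \<in> I" and r: "r \<in> polys {..n}" for r x
  proof -
    obtain c where c: "\<And>m. mon_degree m \<le> d - 1 \<Longrightarrow> coef x m = coef (L c) m"
      using x by (auto simp: I_def)
    have low: "coef x m = 0" if "mon_degree m < d - 1" for m
      using c[of m] coef_form[OF L_form] that by simp
    have "coef (r * x) m = coef (L (\<lambda>j. coef r 0 * c j)) m" if "mon_degree m \<le> d - 1" for m
      using coef_mult_low[OF low that, of r] c[OF that] by (simp flip: L_scale)
    then show ?thesis using x r by (auto simp: I_def intro: mult_in_polys)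
  qed
  have "ideal I (polyring {..n})"
  proof (rule idealI)
    show "subgroup I (add_monoid (polyring {..n}))"
    proof (rule R.add.subgroupI)
      show "I \<subseteq> polys {..n}" by (auto simp: I_def)
      have "0 \<in> I" by (auto simp: I_def L_def intro!: exI[of _ "\<lambda>_. 0"])
      then show "I \<noteq> {}" by auto
      show "\<ominus>\<^bsub>polyring {..n}\<^esub> x \<in> I" if "x \<in> I" for x
      proof -
        have "\<ominus>\<^bsub>polyring {..n}\<^esub> x = Const (- 1) * x"
          using minus[of x] that by (simp add: I_def Const_uminus)
        then show ?thesis using mult_I[OF that Const_in_polys] by metis
      qed
      show "x \<oplus>\<^bsub>polyring {..n}\<^esub> y \<in> I" if xy: "x \<in> I" "y \<in> I" for x y
      proof -
        obtain c c' where "\<And>m. mon_degree m \<le> d - 1 \<Longrightarrow> coef x m = coef (L c) m"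
          "\<And>m. mon_degree m \<le> d - 1 \<Longrightarrow> coef y m = coef (L c') m"
          using xy by (auto simp: I_def)
        then have "\<forall>m. mon_degree m \<le> d - 1 \<longrightarrow> coef (x + y) m = coef (L (\<lambda>j. c j + c' j)) m"
          by (simp add: lookup_add flip: L_add)
        moreover have "x + y \<in> polys {..n}" using xy by (auto simp: I_def intro: add_in_polys)
        ultimately have "x + y \<in> I" unfolding I_def by blast
        then show ?thesis by simp
      qed
    qed
  next
    fix x r assume "x \<in> I" "r \<in> polys {..n}"
    then have "r * x \<in> I" by (rule mult_I)
    then show "r \<otimes>\<^bsub>polyring {..n}\<^esub> x \<in> I" "x \<otimes>\<^bsub>polyring {..n}\<^esub> r \<in> I"
      by (simp_all add: mult.commute)
  qed (rule ring_polyring)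
  moreover have "{partial_deriv i f | i. i \<le> n} \<subseteq> I"
  proof clarify
    fix i assume i: "i \<le> n"
    have "L (\<lambda>j. if j = i then 1 else 0) = (\<Sum>j\<le>n. if j = i then partial_deriv i f else 0)"
      unfolding L_def by (intro sum.cong) auto
    then have "L (\<lambda>j. if j = i then 1 else 0) = partial_deriv i f" using i by (simp add: sum.delta)
    then show "partial_deriv i f \<in> I"
      unfolding I_def using form_polys[OF form_partial_deriv[OF f]]
      by (auto intro!: exI[of _ "\<lambda>j. if j = i then 1 else 0"])
  qed
  ultimately have "jacobian_ideal n f \<subseteq> I"
    unfolding jacobian_ideal_def by (rule R.genideal_minimal)
  then show ?thesis using p by (auto simp: I_def L_def)
qed

text \<open>Row \<open>i\<close> of \<open>B\<close> comes from the membership of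
  \<open>partial_deriv i g\<close> in the Jacobian ideal of \<open>f\<close>. Both sides are forms
  of degree \<open>d - 1\<close>, so agreement up to that degree is equality.\<close>

lemma jacobian_ideal_eq_imp_linear_combination:
  assumes f: "form {..n} d f" and g: "form {..n} d g"
    and eq: "jacobian_ideal n f = jacobian_ideal n g"
  obtains B where "\<And>i. i \<le> n \<Longrightarrow> partial_deriv i g = (\<Sum>j\<le>n. Const (B i j) * partial_deriv j f)"
proof -
  interpret R: ring "polyring {..n}" by (rule ring_polyring)
  have "\<exists>c. partial_deriv i g = (\<Sum>j\<le>n. Const (c j) * partial_deriv j f)" if "i \<le> n" for i
  proof -
    have "{partial_deriv i g | i. i \<le> n} \<subseteq> polys {..n}"
      using form_polys[OF form_partial_deriv[OF g]] by auto
    then have "partial_deriv i g \<in> jacobian_ideal n f"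
      unfolding eq unfolding jacobian_ideal_def using R.genideal_self that by blast
    from jacobian_ideal_low[OF f this] obtain c where
      c: "\<And>m. mon_degree m \<le> d - 1 \<Longrightarrow>
        coef (partial_deriv i g) m = coef (\<Sum>j\<le>n. Const (c j) * partial_deriv j f) m"
      by blast
    have L: "form {..n} (d - 1) (\<Sum>j\<le>n. Const (c j) * partial_deriv j f)"
      by (intro form_sum form_Const_mult form_partial_deriv f)
    then have "coef (partial_deriv i g) m = coef (\<Sum>j\<le>n. Const (c j) * partial_deriv j f) m" for m
      using c[of m] coef_form[OF L, of m] coef_form[OF form_partial_deriv[OF g, of i], of m]
      by (cases "mon_degree m = d - 1") auto
    then show ?thesis by (auto intro: poly_mapping_eqI)
  qed
  then show thesis using that by metis
qed

section \<open>Splitting the variables\<close>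

lemma form_single:
  assumes "mon_degree m = d" "Poly_Mapping.keys m \<subseteq> V"
  shows "form V d (Poly_Mapping.single m c)"
  using assms by (simp add: form_def polys_iff)

text \<open>In \<open>sebastiani_thom_type\<close> the two groups of variables are consecutive;
  \<open>\<sigma>\<close> numbers an arbitrary nonempty proper subset \<open>S\<close> by an initial
  segment.\<close>

lemma bij_betw_initial_segment:
  assumes "S \<subset> {..n}" "S \<noteq> {}"
  obtains l \<sigma> where "l < n" "bij_betw \<sigma> {..n} {..n}" "\<sigma> ` {..l} = S"
    "\<sigma> ` {Suc l..n} = {..n} - S"
proof -
  \<comment> \<open>The segment \<open>{..l}\<close> has \<open>Suc l\<close> elements; the
    subtraction is not truncated because \<open>S\<close> is nonempty.\<close>
  define l where "l = card S - 1"
  have fin: "finite S" using assms(1) finite_subset by blast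
  have "card S < Suc n" using psubset_card_mono[OF _ assms(1)] by simp
  moreover have "card S > 0" using fin assms(2) by (simp add: card_gt_0_iff)
  ultimately have l: "Suc l = card S" "l < n" by (auto simp: l_def)
  obtain \<alpha> where \<alpha>: "bij_betw \<alpha> {..l} S"
    using finite_same_card_bij[of "{..l}" S] fin l by auto
  have "card ({..n} - S) = card {Suc l..n}"
    using assms(1) fin l by (simp add: card_Diff_subset psubset_imp_subset)
  then obtain \<beta> where \<beta>: "bij_betw \<beta> {Suc l..n} ({..n} - S)"
    using finite_same_card_bij[of "{Suc l..n}" "{..n} - S"] by auto
  define \<sigma> where "\<sigma> i = (if i \<in> {..l} then \<alpha> i else \<beta> i)" for i
  have 1: "bij_betw \<sigma> {..l} S"
    using \<alpha> by (subst bij_betw_cong[of _ _ \<alpha>]) (auto simp: \<sigma>_def)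
  have 2: "bij_betw \<sigma> {Suc l..n} ({..n} - S)"
    using \<beta> by (subst bij_betw_cong[of _ _ \<beta>]) (auto simp: \<sigma>_def)
  have "bij_betw \<sigma> ({..l} \<union> {Suc l..n}) (S \<union> ({..n} - S))"
    using 1 2 by (rule bij_betw_combine) auto
  moreover have "{..l} \<union> {Suc l..n} = {..n}" "S \<union> ({..n} - S) = {..n}" using l assms(1) by auto
  ultimately have "bij_betw \<sigma> {..n} {..n}" by simp
  then show thesis using that l 1 2 by (auto simp: bij_betw_def)
qed

text \<open>A monomial with one variable in \<open>S\<close> and another outside would survive in
  the corresponding mixed second derivative, its coefficient multiplied by a nonzero
  integer.\<close>

lemma form_split:
  assumes F: "form {..n} d F" and S: "S \<subseteq> {..n}"
    and D: "\<And>i j. i \<in> S \<Longrightarrow> j \<in> {..n} - S \<Longrightarrow> partial_deriv i (partial_deriv j F) = 0"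
  obtains F1 F2 where "form S d F1" "form ({..n} - S) d F2" "F = F1 + F2"
proof -
  define M where "M = {m \<in> mons F. Poly_Mapping.keys m \<subseteq> S}"
  define part where "part X = (\<Sum>m\<in>X. Poly_Mapping.single m (coef F m))" for X
  have "form S d (part M)"
    unfolding part_def using F by (intro form_sum form_single) (auto simp: M_def form_def)
  moreover have "form ({..n} - S) d (part (mons F - M))"
    unfolding part_def
  proof (intro form_sum form_single)
    fix m assume m: "m \<in> mons F - M"
    then show "mon_degree m = d" using F by (auto simp: form_def)
    have sub: "Poly_Mapping.keys m \<subseteq> {..n}" using F m by (auto simp: form_def polys_iff)
    obtain j where j: "j \<in> Poly_Mapping.keys m" "j \<notin> S" using m by (auto simp: M_def)
    have "i \<notin> S" if "i \<in> Poly_Mapping.keys m" for i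
    proof
      assume i: "i \<in> S"
      let ?e = "\<lambda>i. Poly_Mapping.single i (1::nat)"
      have "i \<noteq> j" using i j by auto
      define m' where "m' = m - ?e i - ?e j"
      have "m = m' + ?e i + ?e j"
      proof (rule poly_mapping_eqI)
        fix k
        show "Poly_Mapping.lookup m k = Poly_Mapping.lookup (m' + ?e i + ?e j) k"
          using \<open>i \<noteq> j\<close> that j unfolding m'_def
          by (cases "k = i"; cases "k = j")
            (simp_all add: lookup_add lookup_minus lookup_single_not_eq in_keys_iff)
      qed
      moreover have "coef (partial_deriv i (partial_deriv j F)) m' = 0"
        using D[of i j] i j sub by auto
      ultimately have "coef F m = 0"
        by (simp add: coef_partial_deriv del: of_nat_Suc)
      then show False using m by (simp add: in_keys_iff)
    qed
    then show "Poly_Mapping.keys m \<subseteq> {..n} - S" using sub by blast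
  qed
  moreover have "F = part M + part (mons F - M)"
  proof -
    have "F = part (mons F)" by (simp add: part_def sum_monomials)
    also have "\<dots> = part M + part (mons F - M)"
      unfolding part_def
      by (subst sum.subset_diff[of M "mons F"]) (auto simp: M_def add.commute)
    finally show ?thesis .
  qed
  ultimately show thesis using that by blast
qed

text \<open>In coordinates in which the columns of \<open>P\<close> are the unit vectors,
  \<open>D\<close> says that the mixed second partial derivatives across \<open>S\<close> vanish, so
  \<open>form_split\<close> applies; \<open>Q\<close> leads back to \<open>f\<close>.\<close>

lemma sebastiani_thom_typeI:
  assumes f: "form {..n} d f" and PQ: "right_inverse n P Q" and QP: "right_inverse n Q P"
    and S: "S \<subset> {..n}" "S \<noteq> {}"
    and D: "\<And>i j. i \<in> S \<Longrightarrow> j \<in> {..n} - S \<Longrightarrow>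
      dir_deriv n (\<lambda>k. P k i) (dir_deriv n (\<lambda>k. P k j) f) = 0"
  shows "sebastiani_thom_type n d f"
proof -
  define F where "F = substitute (lin n P) f"
  have F: "form {..n} d F" unfolding F_def using f by (rule form_substitute) (rule form_lin)
  have f_eq: "f = substitute (lin n Q) F"
    unfolding F_def using substitute_lin_inverse[OF form_polys[OF f] PQ] by simp
  have "partial_deriv i (partial_deriv j F) = 0" if "i \<in> S" "j \<in> {..n} - S" for i j
  proof -
    have "i \<le> n" "j \<le> n" using that S(1) by auto
    then show ?thesis
      by (simp only: F_def D[OF that] substitute_0
          partial_deriv_substitute_lin[OF form_polys[OF f]]
          partial_deriv_substitute_lin[OF form_polys[OF form_dir_deriv[OF f]]])
  qed
  then obtain F1 F2 where F1: "form S d F1" and F2: "form ({..n} - S) d F2" and F12: "F = F1 + F2"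
    using form_split[OF F psubset_imp_subset[OF S(1)]] by metis
  obtain l \<sigma> where l: "l < n" and \<sigma>: "bij_betw \<sigma> {..n} {..n}" "\<sigma> ` {..l} = S"
    "\<sigma> ` {Suc l..n} = {..n} - S"
    using bij_betw_initial_segment[OF S] by metis
  define \<tau> where "\<tau> = inv_into {..n} \<sigma>"
  have \<sigma>_le: "\<sigma> i \<le> n" if "i \<le> n" for i using \<sigma>(1) that by (auto simp: bij_betw_def)
  have \<sigma>_inj: "\<sigma> i = \<sigma> j \<longleftrightarrow> i = j" if "i \<le> n" "j \<le> n" for i j
    using \<sigma>(1) that by (auto simp: bij_betw_def inj_on_def)
  have \<tau>\<sigma>: "\<tau> (\<sigma> i) = i" if "i \<le> n" for i
    unfolding \<tau>_def using \<sigma>(1) that by (auto simp: bij_betw_def)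
  \<comment> \<open>The rows of \<open>Q\<close> are reordered so that the coordinates in
    \<open>S\<close> come first; permuting the columns of \<open>P\<close> alike gives the inverse
    \<open>B\<close>.\<close>
  define A where "A = mat (Suc n) (Suc n) (\<lambda>(i, j). Q (\<sigma> i) j)"
  define B where "B = mat (Suc n) (Suc n) (\<lambda>(i, j). P i (\<sigma> j))"
  have upt: "{0..<Suc n} = {..n}" by auto
  have "A * B = 1\<^sub>m (Suc n)"
    using QP by (intro eq_matI)
      (auto simp: A_def B_def scalar_prod_def upt less_Suc_eq_le right_inverse_def \<sigma>_le \<sigma>_inj)
  moreover have "B * A = 1\<^sub>m (Suc n)"
  proof (rule eq_matI)
    fix i j assume ij: "i < dim_row (1\<^sub>m (Suc n))" "j < dim_col (1\<^sub>m (Suc n))"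
    have "(\<Sum>k\<le>n. P i (\<sigma> k) * Q (\<sigma> k) j) = (\<Sum>k\<le>n. P i k * Q k j)"
      using sum.reindex_bij_betw[OF \<sigma>(1), of "\<lambda>k. P i k * Q k j"] .
    then show "(B * A) $$ (i, j) = 1\<^sub>m (Suc n) $$ (i, j)"
      using PQ ij by (auto simp: A_def B_def scalar_prod_def upt less_Suc_eq_le right_inverse_def)
  qed (auto simp: A_def B_def)
  ultimately have A: "A \<in> carrier_mat (Suc n) (Suc n)" "invertible_mat A"
    by (auto simp: A_def B_def invertible_mat_def inverts_mat_def intro!: exI[of _ B])
  have lin_A: "linear_coordinate n A i = lin n Q (\<sigma> i)" if "i \<le> n" for i
    using that unfolding linear_coordinate_def lin_def by (intro sum.cong) (auto simp: A_def)
  \<comment> \<open>Renaming by \<open>\<tau>\<close> undoes the permutation of the rows in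
    \<open>A\<close>.\<close>
  have rename: "substitute (linear_coordinate n A) (substitute (\<lambda>i. Var (\<tau> i)) G)
      = substitute (lin n Q) G" if "G \<in> polys {..n}" for G
    unfolding substitute_substitute using that
  proof (rule substitute_cong)
    fix i assume "i \<in> {..n}"
    then obtain j where "j \<le> n" "i = \<sigma> j" using \<sigma>(1) by (auto simp: bij_betw_def image_iff)
    then show "substitute (linear_coordinate n A) (Var (\<tau> i)) = lin n Q i"
      by (simp add: \<tau>\<sigma> lin_A)
  qed
  have "form {..l} d (substitute (\<lambda>i. Var (\<tau> i)) F1)"
  proof (rule form_substitute[OF F1 form_Var])
    fix i assume "i \<in> S"
    then show "\<tau> i \<in> {..l}" using \<sigma>(2) \<tau>\<sigma> l by force
  qed
  moreover have "form {Suc l..n} d (substitute (\<lambda>i. Var (\<tau> i)) F2)"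
  proof (rule form_substitute[OF F2 form_Var])
    fix i assume "i \<in> {..n} - S"
    then show "\<tau> i \<in> {Suc l..n}" unfolding \<sigma>(3)[symmetric] using \<tau>\<sigma> by force
  qed
  moreover have "F1 \<in> polys {..n}" "F2 \<in> polys {..n}"
    using form_polys[OF F1] form_polys[OF F2] S by (auto simp: polys_iff)
  then have "f = substitute (linear_coordinate n A) (substitute (\<lambda>i. Var (\<tau> i)) F1)
      + substitute (linear_coordinate n A) (substitute (\<lambda>i. Var (\<tau> i)) F2)"
    by (simp add: rename f_eq F12 substitute_add)
  ultimately show ?thesis
    unfolding sebastiani_thom_type_def using A l by blast
qed

text \<open>Keeping 1 on the diagonal makes the matrix invertible for every \<open>a\<close>; column
  \<open>k\<close> equals \<open>a\<close> exactly when \<open>a k = 1\<close>.\<close>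

definition shear :: "nat \<Rightarrow> (nat \<Rightarrow> complex) \<Rightarrow> nat \<Rightarrow> nat \<Rightarrow> complex" where
  "shear k a i j = (if i = j then 1 else if j = k then a i else 0)"

text \<open>The off-diagonal part of a shear squares to zero, so changing its sign inverts the
  matrix.\<close>

lemma right_inverse_shear:
  assumes "k \<le> n"
  shows "right_inverse n (shear k a) (shear k (\<lambda>i. - a i))"
  unfolding right_inverse_def
proof (intro allI impI)
  fix i j assume "i \<le> n" "j \<le> n"
  let ?b = "\<lambda>i. - a i"
  \<comment> \<open>Only \<open>l = i\<close> and \<open>l = k\<close> contribute; the inner
    condition avoids counting the term twice if \<open>i = k\<close>.\<close>
  have "(\<Sum>l\<le>n. shear k a i l * shear k ?b l j)
      = (\<Sum>l\<le>n. (if l = i then shear k ?b i j else 0)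
        + (if l = k then if i = k then 0 else a i * shear k ?b k j else 0))"
    by (rule sum.cong) (auto simp: shear_def)
  also have "\<dots> = shear k ?b i j + (if i = k then 0 else a i * shear k ?b k j)"
    using \<open>i \<le> n\<close> assms by (simp add: sum.distrib sum.delta)
  also have "\<dots> = (if i = j then 1 else 0)" by (auto simp: shear_def)
  finally show "(\<Sum>l\<le>n. shear k a i l * shear k ?b l j) = (if i = j then 1 else 0)" .
qed

lemma right_inverse_shear':
  assumes "k \<le> n"
  shows "right_inverse n (shear k (\<lambda>i. - a i)) (shear k a)"
  using right_inverse_shear[OF assms, of "\<lambda>i. - a i"] by simp

lemma shear_column: "a k = 1 \<Longrightarrow> (\<lambda>i. shear k a i k) = a"
  by (auto simp: shear_def)

section \<open>Jordan normal form\<close>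

text \<open>By induction over the blocks: the superdiagonal entry at the junction of two blocks is
  zero, so a nonzero one lies inside a block and its diagonal neighbours share the
  eigenvalue.\<close>

lemma jordan_matrix_entries:
  fixes n_as :: "(nat \<times> 'a::{zero_neq_one}) list"
  defines "J \<equiv> jordan_matrix n_as" and "N \<equiv> sum_list (map fst n_as)"
  shows jordan_matrix_eq_0: "i < N \<Longrightarrow> j < N \<Longrightarrow> j \<noteq> i \<Longrightarrow> j \<noteq> Suc i \<Longrightarrow> J $$ (i, j) = 0"
    and jordan_matrix_superdiagonal: "Suc i < N \<Longrightarrow> J $$ (i, Suc i) \<noteq> 0 \<Longrightarrow>
      J $$ (i, Suc i) = 1 \<and> J $$ (Suc i, Suc i) = J $$ (i, i)"
proof -
  have "(i < N \<longrightarrow> j < N \<longrightarrow> j \<noteq> i \<longrightarrow> j \<noteq> Suc i \<longrightarrow> J $$ (i, j) = 0) \<and>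
    (Suc i < N \<longrightarrow> J $$ (i, Suc i) \<noteq> 0 \<longrightarrow>
      J $$ (i, Suc i) = 1 \<and> J $$ (Suc i, Suc i) = J $$ (i, i))"
    unfolding J_def N_def
  proof (induction n_as arbitrary: i j)
    case (Cons na n_as)
    obtain m a where na: "na = (m, a)" by force
    have IH1: "jordan_matrix n_as $$ (i - m, j - m) = 0"
      if "\<not> i < m" "\<not> j < m" "i < m + sum_list (map fst n_as)" "j < m + sum_list (map fst n_as)"
        "j \<noteq> i" "j \<noteq> Suc i"
      using Cons[of "i - m" "j - m"] that by auto
    have IH2: "jordan_matrix n_as $$ (i - m, Suc i - m) = 1 \<and>
        jordan_matrix n_as $$ (Suc i - m, Suc i - m) = jordan_matrix n_as $$ (i - m, i - m)"
      if "\<not> i < m" "Suc i < m + sum_list (map fst n_as)"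
        "jordan_matrix n_as $$ (i - m, Suc i - m) \<noteq> 0"
      using Cons[of "i - m" "j - m"] that by (auto simp: Suc_diff_le not_less)
    show ?case
      using IH1 IH2 by (auto simp: na jordan_matrix_Cons)
  qed simp
  then show "i < N \<Longrightarrow> j < N \<Longrightarrow> j \<noteq> i \<Longrightarrow> j \<noteq> Suc i \<Longrightarrow> J $$ (i, j) = 0"
    and "Suc i < N \<Longrightarrow> J $$ (i, Suc i) \<noteq> 0 \<Longrightarrow>
      J $$ (i, Suc i) = 1 \<and> J $$ (Suc i, Suc i) = J $$ (i, i)"
    by blast+
qed

text \<open>With a Jordan decomposition \<open>A = P J Q\<close>, read \<open>A P = P J\<close>
  column by column. If the superdiagonal of \<open>J\<close> vanishes, the columns of
  \<open>P\<close> are eigenvectors; otherwise two consecutive columns of one chain form the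
  pair.\<close>

lemma jordan_pair_or_eigenbasis:
  fixes T :: "nat \<Rightarrow> nat \<Rightarrow> complex"
  obtains (jordan_pair) v w a k where "k \<le> n" "v k \<noteq> 0"
      "\<And>i. i \<le> n \<Longrightarrow> (\<Sum>j\<le>n. T i j * v j) = a * v i"
      "\<And>i. i \<le> n \<Longrightarrow> (\<Sum>j\<le>n. T i j * w j) = a * w i + v i"
    | (eigenbasis) P Q \<mu> where "right_inverse n P Q" "right_inverse n Q P"
      "\<And>i k. i \<le> n \<Longrightarrow> k \<le> n \<Longrightarrow> (\<Sum>j\<le>n. T i j * P j k) = \<mu> k * P i k"
proof -
  define A where "A = mat (Suc n) (Suc n) (\<lambda>(i, j). T i j)"
  have A: "A \<in> carrier_mat (Suc n) (Suc n)" by (simp add: A_def)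
  obtain as where "char_poly A = (\<Prod>a\<leftarrow>as. [:- a, 1:])"
    using char_poly_factorized[OF A] by blast
  from jordan_nf_exists[OF A this] obtain n_as where "jordan_nf A n_as" by blast
  then obtain P Q where wit: "similar_mat_wit A (jordan_matrix n_as) P Q"
    by (auto simp: jordan_nf_def similar_mat_def)
  note wD = similar_mat_witD2[OF A wit]
  define J where "J = jordan_matrix n_as"
  have carr: "J \<in> carrier_mat (Suc n) (Suc n)" "P \<in> carrier_mat (Suc n) (Suc n)"
    "Q \<in> carrier_mat (Suc n) (Suc n)"
    and PQ: "P * Q = 1\<^sub>m (Suc n)" and QP: "Q * P = 1\<^sub>m (Suc n)" and AJ: "A = P * J * Q"
    unfolding J_def by (fact wD)+
  have N: "sum_list (map fst n_as) = Suc n" using carrier_matD(1)[OF carr(1)] by (simp add: J_def)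
  have PJ: "P * J \<in> carrier_mat (Suc n) (Suc n)" using carr(2,1) by (rule mult_carrier_mat)
  have AP: "A * P = P * J"
    unfolding AJ assoc_mult_mat[OF PJ carr(3,2)] QP by (rule right_mult_one_mat[OF PJ])
  have upt: "{0..<Suc n} = {..n}" by auto
  have mult: "(X * Y) $$ (i, k) = (\<Sum>j\<le>n. X $$ (i, j) * Y $$ (j, k))"
    if "X \<in> carrier_mat (Suc n) (Suc n)" "Y \<in> carrier_mat (Suc n) (Suc n)" "i \<le> n" "k \<le> n"
    for X Y :: "complex mat" and i k
    using that by (auto simp: scalar_prod_def upt intro!: sum.cong)
  have TP: "(\<Sum>j\<le>n. T i j * P $$ (j, k)) = (\<Sum>j\<le>n. P $$ (i, j) * J $$ (j, k))"
    if "i \<le> n" "k \<le> n" for i k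
  proof -
    have "(\<Sum>j\<le>n. T i j * P $$ (j, k)) = (A * P) $$ (i, k)"
      unfolding mult[OF A carr(2) that] using that by (intro sum.cong) (auto simp: A_def)
    then show ?thesis unfolding AP mult[OF carr(2) carr(1) that] .
  qed
  have inv1: "right_inverse n (\<lambda>i j. P $$ (i, j)) (\<lambda>i j. Q $$ (i, j))"
    and inv2: "right_inverse n (\<lambda>i j. Q $$ (i, j)) (\<lambda>i j. P $$ (i, j))"
    using mult[OF carr(2,3)] mult[OF carr(3,2)] unfolding PQ QP by (auto simp: right_inverse_def)
  have J0: "J $$ (i, j) = 0" if "i \<le> n" "j \<le> n" "j \<noteq> i" "j \<noteq> Suc i" for i j
    unfolding J_def using that N by (intro jordan_matrix_eq_0) auto
  show thesis
  proof (cases "\<exists>i. i < n \<and> J $$ (i, Suc i) \<noteq> 0")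
    case False
    have "(\<Sum>j\<le>n. T i j * P $$ (j, k)) = J $$ (k, k) * P $$ (i, k)" if "i \<le> n" "k \<le> n" for i k
    proof -
      have "(\<Sum>j\<le>n. P $$ (i, j) * J $$ (j, k)) = (\<Sum>j\<le>n. if j = k then P $$ (i, k) * J $$ (k, k) else 0)"
      proof (rule sum.cong[OF refl])
        fix j assume "j \<in> {..n}"
        then show "P $$ (i, j) * J $$ (j, k) = (if j = k then P $$ (i, k) * J $$ (k, k) else 0)"
          using J0[of j k] False that by (cases "k = Suc j") auto
      qed
      then show ?thesis using TP[OF that] that by (simp add: sum.delta mult.commute)
    qed
    then show thesis by (rule eigenbasis[OF inv1 inv2, of "\<lambda>k. J $$ (k, k)"])
  next
    case True
    \<comment> \<open>Minimality makes the superdiagonal entry in column \<open>i\<close> zero, so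
      column \<open>i\<close> of \<open>P\<close> is an eigenvector that starts a chain.\<close>
    define i where "i = (LEAST i. i < n \<and> J $$ (i, Suc i) \<noteq> 0)"
    have i: "i < n" "J $$ (i, Suc i) \<noteq> 0"
      using LeastI_ex[OF True] unfolding i_def by auto
    have least: "J $$ (j, Suc j) = 0" if "j < i" for j
      using not_less_Least[OF that[unfolded i_def]] that i(1) by auto
    have block: "J $$ (i, Suc i) = 1" "J $$ (Suc i, Suc i) = J $$ (i, i)"
      using jordan_matrix_superdiagonal[of i n_as] i N by (auto simp: J_def)
    \<comment> \<open>A diagonal entry of \<open>Q P = 1\<close> shows that the eigenvector is
      nonzero and supplies the index \<open>k\<close>.\<close>
    have "(\<Sum>j\<le>n. Q $$ (i, j) * P $$ (j, i)) = 1"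
      using inv2 i by (auto simp: right_inverse_def)
    then obtain k where k: "k \<le> n" "P $$ (k, i) \<noteq> 0"
      by (metis (no_types, lifting) atMost_iff mult_zero_right sum.neutral zero_neq_one)
    have v: "(\<Sum>j\<le>n. T r j * P $$ (j, i)) = J $$ (i, i) * P $$ (r, i)" if "r \<le> n" for r
    proof -
      have "(\<Sum>j\<le>n. P $$ (r, j) * J $$ (j, i)) = (\<Sum>j\<le>n. if j = i then P $$ (r, i) * J $$ (i, i) else 0)"
      proof (rule sum.cong[OF refl])
        fix j assume "j \<in> {..n}"
        then show "P $$ (r, j) * J $$ (j, i) = (if j = i then P $$ (r, i) * J $$ (i, i) else 0)"
          using J0[of j i] least[of j] i by (cases "i = Suc j") auto
      qed
      then show ?thesis using TP[OF that, of i] i by (simp add: sum.delta mult.commute)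
    qed
    have w: "(\<Sum>j\<le>n. T r j * P $$ (j, Suc i)) = J $$ (i, i) * P $$ (r, Suc i) + P $$ (r, i)"
      if "r \<le> n" for r
    proof -
      have "(\<Sum>j\<le>n. P $$ (r, j) * J $$ (j, Suc i))
        = (\<Sum>j\<le>n. (if j = Suc i then P $$ (r, Suc i) * J $$ (i, i) else 0)
          + (if j = i then P $$ (r, i) else 0))"
      proof (rule sum.cong[OF refl])
        fix j assume "j \<in> {..n}"
        then show "P $$ (r, j) * J $$ (j, Suc i)
          = (if j = Suc i then P $$ (r, Suc i) * J $$ (i, i) else 0) + (if j = i then P $$ (r, i) else 0)"
          using J0[of j "Suc i"] block i by auto
      qed
      then show ?thesis using TP[OF that, of "Suc i"] i
        by (simp add: sum.delta sum.distrib mult.commute)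
    qed
    show thesis
      by (rule jordan_pair[OF k(1), of "\<lambda>j. P $$ (j, i)", OF k(2)]) (use v w in auto)
  qed
qed

section \<open>Order of vanishing in the local ring\<close>

text \<open>Order of vanishing at the origin; the zero polynomial satisfies this for every
  \<open>e\<close>.\<close>

definition order_ge :: "nat \<Rightarrow> cpoly \<Rightarrow> bool" where
  "order_ge e p \<longleftrightarrow> (\<forall>m\<in>mons p. e \<le> mon_degree m)"

lemma order_ge_add: "order_ge e p \<Longrightarrow> order_ge e q \<Longrightarrow> order_ge e (p + q)"
  unfolding order_ge_def using keys_add[of p q] by blast

lemma order_ge_diff: "order_ge e p \<Longrightarrow> order_ge e q \<Longrightarrow> order_ge e (p - q)"
  using order_ge_add[of e p "- q"] by (simp add: order_ge_def)

lemma order_ge_mult: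
  assumes "order_ge e p" "order_ge e' q"
  shows "order_ge (e + e') (p * q)"
  unfolding order_ge_def
proof
  fix m assume "m \<in> mons (p * q)"
  then obtain a b where "m = a + b" "a \<in> mons p" "b \<in> mons q" using keys_mult[of p q] by blast
  then show "e + e' \<le> mon_degree m" using assms by (auto simp: order_ge_def mon_degree_add add_mono)
qed

lemma order_ge_0 [simp]: "order_ge 0 p"
  by (simp add: order_ge_def)

lemma order_ge_1_iff: "order_ge 1 p \<longleftrightarrow> coef p 0 = 0"
proof
  show "coef p 0 = 0" if "order_ge 1 p"
    using that unfolding order_ge_def by (metis in_keys_iff mon_degree_zero not_one_le_zero)
  show "order_ge 1 p" if "coef p 0 = 0"
    unfolding order_ge_def
  proof
    fix m assume "m \<in> mons p"
    then have "m \<noteq> 0" using that by (auto simp: in_keys_iff)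
    then have "mon_degree m \<noteq> 0" by (simp only: mon_degree_eq_0_iff not_False_eq_True)
    then show "1 \<le> mon_degree m" by linarith
  qed
qed

lemma form_order_ge: "form V d p \<Longrightarrow> e \<le> d \<Longrightarrow> order_ge e p"
  by (simp add: form_def order_ge_def)

lemma form_order_ge_Suc_eq_0:
  assumes "form V d p" "order_ge (Suc d) p"
  shows "p = 0"
proof -
  have "mons p = {}" using assms by (fastforce simp: form_def order_ge_def)
  then show ?thesis by simp
qed

lemma coef_mult_0: "coef (p * q) 0 = coef p 0 * coef q 0"
  by (rule coef_mult_low[of 0]) simp_all

lemma coef_Const_0 [simp]: "coef (Const c) 0 = c"
  by (simp add: Const_def)

lemma coef_Var_0 [simp]: "coef (Var i) 0 = 0"
proof -
  have "Poly_Mapping.single i (1::nat) \<noteq> 0" by (metis mon_degree_single mon_degree_zero one_neq_zero)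
  then show ?thesis unfolding Var_def by (rule lookup_single_not_eq)
qed

text \<open>Translation moves the point \<open>a\<close> to the origin, so that vanishing at
  \<open>a\<close> becomes \<open>order_ge 1\<close>.\<close>

lemma coef_0_shift: "coef (substitute (\<lambda>i. Var i + Const (a i)) p) 0 = eval_at a p"
proof -
  have "p \<in> polys UNIV" by (simp add: polys_iff)
  then show ?thesis
    by (induction p rule: polys_induct)
      (simp_all add: substitute_add substitute_mult eval_at_add eval_at_mult lookup_add coef_mult_0)
qed

lemma eval_at_uminus: "eval_at a (- f) = - eval_at a f"
  using eval_at_add[of a f "- f"] by (simp add: eq_neg_iff_add_eq_0 add.commute)

lemma eval_at_diff: "eval_at a (f - g) = eval_at a f - eval_at a g"
  using eval_at_add[of a f "- g"] by (simp add: eval_at_uminus)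

section \<open>Powers of the maximal ideal of the local ring\<close>

lemma local_max_ideal_power_0:
  "local_max_ideal_power V a 0 = carrier (local_ring V a)"
  by (simp add: local_max_ideal_power_def nat_pow_def ideals_set_def)

lemma local_max_ideal_power_Suc:
  "local_max_ideal_power V a (Suc e)
     = ideal_prod (local_ring V a) (local_max_ideal_power V a e) (local_max_ideal V a)"
  by (simp add: local_max_ideal_power_def nat_pow_def ideals_set_def)

lemma local_ring_simps:
  "x \<oplus>\<^bsub>local_ring V a\<^esub> y = x + y" "x \<otimes>\<^bsub>local_ring V a\<^esub> y = x * y"
  by (simp_all add: local_ring_def)

lemma eval_at_nonzero: "eval_at a s \<noteq> 0 \<Longrightarrow> s \<noteq> 0"
  by auto

text \<open>Each further factor from the maximal ideal raises the order by one. Sums are put over a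
  common denominator, which does not vanish at \<open>a\<close>.\<close>

lemma local_max_ideal_power_order:
  assumes "x \<in> local_max_ideal_power V a e"
  shows "\<exists>u s. x = Fraction_Field.Fract u s \<and> eval_at a s \<noteq> 0 \<and>
    order_ge e (substitute (\<lambda>i. Var i + Const (a i)) u)"
  using assms
proof (induction e arbitrary: x)
  case 0
  then show ?case by (auto simp: local_max_ideal_power_0 local_ring_def)
next
  case (Suc e)
  let ?\<tau> = "substitute (\<lambda>i. Var i + Const (a i))"
  from Suc.prems show ?case
    unfolding local_max_ideal_power_Suc
  proof (induction x rule: ideal_prod.induct)
    case (prod x y)
    obtain u s where x: "x = Fraction_Field.Fract u s" "eval_at a s \<noteq> 0" "order_ge e (?\<tau> u)"
      using Suc.IH[OF prod(1)] by blast
    obtain u' s' where y: "y = Fraction_Field.Fract u' s'" "eval_at a u' = 0" "eval_at a s' \<noteq> 0"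
      using prod(2) by (auto simp: local_max_ideal_def)
    have "order_ge 1 (?\<tau> u')" unfolding order_ge_1_iff coef_0_shift by (rule y(2))
    from order_ge_mult[OF x(3) this] have "order_ge (Suc e) (?\<tau> (u * u'))"
      by (simp add: substitute_mult)
    moreover have "x * y = Fraction_Field.Fract (u * u') (s * s')" using x y by simp
    moreover have "eval_at a (s * s') \<noteq> 0" using x y by (simp add: eval_at_mult)
    ultimately show ?case unfolding local_ring_simps by blast
  next
    case (sum x y)
    obtain u s where x: "x = Fraction_Field.Fract u s" "eval_at a s \<noteq> 0" "order_ge (Suc e) (?\<tau> u)"
      using sum.IH(1) by blast
    obtain u' s' where y: "y = Fraction_Field.Fract u' s'" "eval_at a s' \<noteq> 0" "order_ge (Suc e) (?\<tau> u')"
      using sum.IH(2) by blast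
    have "order_ge (Suc e) (?\<tau> (u * s' + u' * s))"
      using order_ge_mult[OF x(3) order_ge_0] order_ge_mult[OF y(3) order_ge_0]
      by (auto simp: substitute_add substitute_mult intro!: order_ge_add)
    moreover have "x + y = Fraction_Field.Fract (u * s' + u' * s) (s * s')"
      using x y eval_at_nonzero by simp
    moreover have "eval_at a (s * s') \<noteq> 0" using x y by (simp add: eval_at_mult)
    ultimately show ?case unfolding local_ring_simps by blast
  qed
qed

lemma Fract_in_local_ring: "u \<in> polys V \<Longrightarrow> Fraction_Field.Fract u 1 \<in> carrier (local_ring V a)"
  unfolding local_ring_def by simp (metis one_in_polys eval_at_1 one_neq_zero)

lemma Fract_in_local_max_ideal:
  "u \<in> polys V \<Longrightarrow> eval_at a u = 0 \<Longrightarrow> Fraction_Field.Fract u 1 \<in> local_max_ideal V a"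
  unfolding local_max_ideal_def by simp (metis one_in_polys eval_at_1 one_neq_zero)

lemma zero_in_local_max_ideal: "0 \<in> local_max_ideal V a"
  unfolding Zero_fract_def by (rule Fract_in_local_max_ideal) simp_all

lemma zero_in_local_max_ideal_power: "0 \<in> local_max_ideal_power V a e"
proof (induction e)
  case 0
  show ?case
    unfolding local_max_ideal_power_0 Zero_fract_def by (rule Fract_in_local_ring) simp
next
  case (Suc e)
  show ?case
    using ideal_prod.prod[OF Suc zero_in_local_max_ideal, of "local_ring V a"]
    by (simp add: local_max_ideal_power_Suc local_ring_simps)
qed

lemma add_in_local_max_ideal_power:
  assumes "x \<in> local_max_ideal_power V a e" "y \<in> local_max_ideal_power V a e"
  shows "x + y \<in> local_max_ideal_power V a e"
proof (cases e)
  \<comment> \<open>The zeroth power is the whole local ring rather than an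
    \<open>ideal_prod\<close>, so closure under sums is checked with a common denominator.\<close>
  case 0
  obtain u s u' s' where "x = Fraction_Field.Fract u s" "y = Fraction_Field.Fract u' s'"
    "u \<in> polys V" "s \<in> polys V" "u' \<in> polys V" "s' \<in> polys V" "eval_at a s \<noteq> 0" "eval_at a s' \<noteq> 0"
    using assms by (auto simp: 0 local_max_ideal_power_0 local_ring_def)
  moreover from this have "x + y = Fraction_Field.Fract (u * s' + u' * s) (s * s')"
    using eval_at_nonzero by simp
  moreover have "u * s' + u' * s \<in> polys V" "s * s' \<in> polys V" "eval_at a (s * s') \<noteq> 0"
    using calculation by (auto intro: add_in_polys mult_in_polys simp: eval_at_mult)
  ultimately show ?thesis unfolding 0 local_max_ideal_power_0 local_ring_def by auto
next
  case (Suc e')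
  show ?thesis
    using ideal_prod.sum[OF assms[unfolded Suc local_max_ideal_power_Suc]]
    by (simp add: Suc local_max_ideal_power_Suc local_ring_simps)
qed

text \<open>Peel off one linear factor at a time: each lies in the maximal ideal, and after
  \<open>e\<close> steps the rest still lies in the local ring.\<close>

lemma monomial_in_local_max_ideal_power:
  assumes "Poly_Mapping.keys m \<subseteq> V" "e \<le> mon_degree m"
  shows "Fraction_Field.Fract (Const c * mon_value (\<lambda>i. Var i - Const (a i)) m) 1
    \<in> local_max_ideal_power V a e"
  using assms
proof (induction e arbitrary: m)
  case 0
  have "Const c * mon_value (\<lambda>i. Var i - Const (a i)) m \<in> polys V"
    unfolding mon_value_def using 0(1)
    by (intro mult_in_polys prod_in_polys power_in_polys diff_in_polys) (auto intro: Var_in_polys)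
  then show ?case
    unfolding local_max_ideal_power_0 by (rule Fract_in_local_ring)
next
  case (Suc e)
  let ?\<rho> = "\<lambda>i. Var i - Const (a i)"
  have "Poly_Mapping.keys m \<noteq> {}" using Suc.prems(2) by (auto simp: mon_degree_def)
  then obtain i where i: "i \<in> Poly_Mapping.keys m" by blast
  define m' where "m' = m - Poly_Mapping.single i 1"
  have m: "m = m' + Poly_Mapping.single i 1"
    unfolding m'_def using minus_single_add[OF i] by simp
  have "Poly_Mapping.keys m' \<subseteq> Poly_Mapping.keys m"
    by (auto simp: m'_def in_keys_iff lookup_minus)
  then have IH: "Fraction_Field.Fract (Const c * mon_value ?\<rho> m') 1 \<in> local_max_ideal_power V a e"
    using Suc.prems by (intro Suc.IH) (auto simp: m mon_degree_add)
  have "?\<rho> i \<in> polys V" "eval_at a (?\<rho> i) = 0"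
    using i Suc.prems(1) by (auto intro!: diff_in_polys Var_in_polys simp: eval_at_diff)
  then have "Fraction_Field.Fract (?\<rho> i) 1 \<in> local_max_ideal V a"
    by (rule Fract_in_local_max_ideal)
  from ideal_prod.prod[OF IH this, of "local_ring V a"] show ?case
    by (simp add: local_max_ideal_power_Suc local_ring_simps m mon_value_add mult.assoc)
qed

lemma substitute_in_local_max_ideal_power:
  assumes "p \<in> polys V" "order_ge e p"
  shows "Fraction_Field.Fract (substitute (\<lambda>i. Var i - Const (a i)) p) 1 \<in> local_max_ideal_power V a e"
proof (induction p rule: poly_mapping_sum_induct)
  case zero
  show ?case using zero_in_local_max_ideal_power by (simp add: Zero_fract_def)
next
  case (single m)
  show ?case
    unfolding substitute_single
    using single assms by (intro monomial_in_local_max_ideal_power) (auto simp: polys_iff order_ge_def)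
next
  case (add p q)
  then show ?case
    using add_in_local_max_ideal_power[OF add] by (simp add: substitute_add)
qed

text \<open>Clearing the denominator and moving \<open>a\<close> to the origin multiplies
  \<open>A + C\<close> by a polynomial with nonzero constant term \<open>c\<close>. The component of
  degree \<open>e\<close> becomes \<open>c\<close> times \<open>A\<close>, which is not
  zero.\<close>

lemma not_in_local_max_ideal_power:
  assumes A: "form V e A" "A \<noteq> 0" and C: "form V (Suc e) C"
  shows "Fraction_Field.Fract (substitute (\<lambda>i. Var i - Const (a i)) (A + C)) 1
    \<notin> local_max_ideal_power V a (Suc e)"
proof
  let ?\<tau> = "substitute (\<lambda>i. Var i + Const (a i))"
  let ?\<phi> = "substitute (\<lambda>i. Var i - Const (a i)) (A + C)"
  assume "Fraction_Field.Fract ?\<phi> 1 \<in> local_max_ideal_power V a (Suc e)"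
  then obtain u s where us: "Fraction_Field.Fract ?\<phi> 1 = Fraction_Field.Fract u s"
    "eval_at a s \<noteq> 0" "order_ge (Suc e) (?\<tau> u)"
    using local_max_ideal_power_order by blast
  have "?\<phi> * s = u" using us(1) eval_at_nonzero[OF us(2)] by (simp add: eq_fract)
  then have "?\<tau> u = ?\<tau> ?\<phi> * ?\<tau> s" by (simp flip: substitute_mult)
  also have "?\<tau> ?\<phi> = A + C" by (simp add: substitute_substitute substitute_diff)
  finally have u: "?\<tau> u = (A + C) * ?\<tau> s" .
  define c where "c = coef (?\<tau> s) 0"
  have "c \<noteq> 0" using us(2) by (simp add: c_def coef_0_shift)
  have "order_ge 1 (?\<tau> s - Const c)"
    by (simp add: order_ge_1_iff c_def lookup_minus Const_def del: One_nat_def)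
  then have "order_ge (Suc e) (A * (?\<tau> s - Const c))"
    using order_ge_mult[OF form_order_ge[OF A(1) order_refl]] by fastforce
  moreover have "order_ge (Suc e) (C * ?\<tau> s)"
    using order_ge_mult[OF form_order_ge[OF C order_refl] order_ge_0] by fastforce
  \<comment> \<open>All three terms on the right have order at least \<open>Suc e\<close>, while the
    left side is a form of degree \<open>e\<close>.\<close>
  moreover have "Const c * A = ?\<tau> u - A * (?\<tau> s - Const c) - C * ?\<tau> s"
    by (simp add: u algebra_simps)
  ultimately have "order_ge (Suc e) (Const c * A)"
    using us(3) by (simp add: order_ge_diff)
  then have "Const c * A = 0"
    using form_order_ge_Suc_eq_0 form_Const_mult[OF A(1)] by blast
  then show False using A(2) \<open>c \<noteq> 0\<close> by simp
qed

section \<open>Singularities of multiplicity one less than the degree\<close>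

text \<open>In characteristic zero, differentiating a monomial that contains \<open>x_k\<close>
  multiplies its coefficient by a nonzero integer, and distinct such monomials cannot
  cancel.\<close>

lemma form_without_variable:
  assumes p: "form {..n} d p" and 0: "partial_deriv k p = 0"
  shows "form ({..n} - {k}) d p"
  unfolding form_def polys_iff
proof (intro conjI ballI)
  fix m assume m: "m \<in> mons p"
  then show "mon_degree m = d" using p by (simp add: form_def)
  have "k \<notin> Poly_Mapping.keys m"
  proof
    assume k: "k \<in> Poly_Mapping.keys m"
    define m' where "m' = m - Poly_Mapping.single k 1"
    have m_eq: "m = m' + Poly_Mapping.single k 1"
      unfolding m'_def using minus_single_add[OF k] by simp
    have "coef (partial_deriv k p) m' = 0" using 0 by simp
    then have "coef p m = 0" unfolding m_eq coef_partial_deriv by (simp del: of_nat_Suc)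
    then show False using m by (simp add: in_keys_iff)
  qed
  then show "Poly_Mapping.keys m \<subseteq> {..n} - {k}"
    using m p by (auto simp: form_def polys_iff)
qed

lemma eval_at_form_eq_0:
  assumes "form V d p" "d > 0" "\<And>i. i \<in> V \<Longrightarrow> b i = 0"
  shows "eval_at b p = 0"
  unfolding eval_at_def
proof (intro sum.neutral ballI)
  fix m assume m: "m \<in> mons p"
  then have "Poly_Mapping.keys m \<noteq> {}" "Poly_Mapping.keys m \<subseteq> V"
    using assms(1,2) by (auto simp: form_def polys_iff mon_degree_def)
  then obtain i where "i \<in> Poly_Mapping.keys m" "b i = 0" using assms(3) by blast
  then have "(\<Prod>i\<in>Poly_Mapping.keys m. b i ^ Poly_Mapping.lookup m i) = 0"
    by (intro prod_zero) (auto simp: in_keys_iff intro!: bexI[of _ i])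
  then show "coef p m * (\<Prod>i\<in>Poly_Mapping.keys m. b i ^ Poly_Mapping.lookup m i) = 0" by simp
qed

lemma lin_shear:
  assumes "k \<le> n" "i \<le> n"
  shows "lin n (shear k a) i = (if i = k then Var k else Var i + Const (a i) * Var k)"
proof -
  have "lin n (shear k a) i = (\<Sum>j\<le>n. (if j = i then Var i else 0)
      + (if j = k then if i = k then 0 else Const (a i) * Var k else 0))"
    unfolding lin_def by (rule sum.cong) (auto simp: shear_def)
  then show ?thesis using assms by (auto simp: sum.distrib sum.delta)
qed

text \<open>The shear maps the \<open>k\<close>-th unit vector to \<open>a\<close>.\<close>

lemma linear_in_direction:
  assumes f: "form {..n} (Suc e) f" and k: "k \<le> n" and a: "a k = 1"
    and D: "dir_deriv n a f \<noteq> 0" "dir_deriv n a (dir_deriv n a f) = 0"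
  obtains A C where "form ({..n} - {k}) e A" "A \<noteq> 0" "form ({..n} - {k}) (Suc e) C"
    "f = substitute (lin n (shear k (\<lambda>i. - a i))) (Var k * A + C)"
proof -
  define F where "F = substitute (lin n (shear k a)) f"
  \<comment> \<open>The vanishing second derivative along \<open>a\<close> makes \<open>A\<close>
    free of \<open>x_k\<close>, and therefore also the remainder \<open>C\<close>.\<close>
  define A where "A = partial_deriv k F"
  define C where "C = F - Var k * A"
  have F: "form {..n} (Suc e) F"
    unfolding F_def using f by (rule form_substitute) (rule form_lin)
  have A_eq: "A = substitute (lin n (shear k a)) (dir_deriv n a f)"
    unfolding A_def F_def
    by (simp add: partial_deriv_substitute_lin form_polys[OF f] k shear_column a)
  have A0: "partial_deriv k A = 0"
    unfolding A_eq
    by (simp add: partial_deriv_substitute_lin form_polys[OF form_dir_deriv[OF f]] k shear_column a D(2))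
  have "A \<noteq> 0"
  proof
    assume "A = 0"
    then have "substitute (lin n (shear k (\<lambda>i. - a i))) (substitute (lin n (shear k a)) (dir_deriv n a f)) = 0"
      by (simp flip: A_eq)
    then show False
      using D(1) substitute_lin_inverse[OF form_polys[OF form_dir_deriv[OF f]] right_inverse_shear[OF k]]
      by simp
  qed
  have An: "form {..n} e A"
    using form_partial_deriv[OF F, of k] by (simp add: A_def)
  then have "form {..n} (Suc e) (Var k * A)"
    using form_mult[OF form_Var, of k "{..n}" e A] k by simp
  then have "form {..n} (Suc e) C" unfolding C_def using F by (rule form_diff[rotated])
  moreover have "partial_deriv k C = 0"
  proof -
    have "partial_deriv k F = partial_deriv k (C + Var k * A)" by (simp add: C_def)
    also have "\<dots> = partial_deriv k C + A"
      by (simp only: partial_deriv_add partial_deriv_mult A0 partial_deriv_Var) simp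
    finally show ?thesis by (simp add: A_def)
  qed
  ultimately have "form ({..n} - {k}) (Suc e) C" by (rule form_without_variable)
  moreover have "form ({..n} - {k}) e A" using An A0 by (rule form_without_variable)
  moreover have "f = substitute (lin n (shear k (\<lambda>i. - a i))) (Var k * A + C)"
    using substitute_lin_inverse[OF form_polys[OF f] right_inverse_shear[OF k]]
    by (simp add: C_def F_def)
  ultimately show thesis using that \<open>A \<noteq> 0\<close> by blast
qed

text \<open>With the point moved to the \<open>k\<close>-th unit vector, \<open>f\<close> becomes
  \<open>x_k A + C\<close>. Setting \<open>x_k = 1\<close> leaves the local equation
  \<open>A + C\<close>, whose lowest component \<open>A\<close> has degree \<open>e\<close>.\<close>

lemma singular_point_of_multiplicity:
  assumes f: "form {..n} (Suc e) f" and e: "e > 0" and p: "p \<in> carrier_vec (Suc n)"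
    and k: "k \<le> n" "p $ k \<noteq> 0"
    and D: "dir_deriv n (\<lambda>i. p $ i) f \<noteq> 0"
      "dir_deriv n (\<lambda>i. p $ i) (dir_deriv n (\<lambda>i. p $ i) f) = 0"
  shows "p \<in> hypersurface_points n f \<and> has_multiplicity n f p e"
proof
  let ?V = "{..n} - {k}"
  \<comment> \<open>Rescaling gives at once the affine coordinates in the chart and the
    normalisation \<open>a k = 1\<close> needed for the shear.\<close>
  define a where "a = (\<lambda>i. p $ i / p $ k)"
  have p_eq: "(\<lambda>i. p $ i) = (\<lambda>i. p $ k * a i)" using k by (auto simp: a_def)
  have scale: "dir_deriv n (\<lambda>i. p $ i) h = Const (p $ k) * dir_deriv n a h" for h
    using dir_deriv_scale[of n "p $ k" a h] unfolding p_eq[symmetric] .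
  have a: "a k = 1" using k by (simp add: a_def)
  have "dir_deriv n a f \<noteq> 0" "dir_deriv n a (dir_deriv n a f) = 0"
    using D k by (auto simp: scale dir_deriv_Const_mult)
  from linear_in_direction[OF f k(1) a this] obtain A C where
    A: "form ?V e A" "A \<noteq> 0" and C: "form ?V (Suc e) C"
    and f_eq: "f = substitute (lin n (shear k (\<lambda>i. - a i))) (Var k * A + C)"
    by metis
  \<comment> \<open>The coordinates of \<open>p\<close> after the shear; all but the
    \<open>k\<close>-th vanish, which kills both \<open>A\<close> and \<open>C\<close>.\<close>
  define b where "b i = eval_at (\<lambda>i. p $ i) (lin n (shear k (\<lambda>i. - a i)) i)" for i
  have b: "b i = 0" if "i \<in> ?V" for i
    using that k by (auto simp: b_def lin_shear eval_at_add eval_at_mult Const_uminus eval_at_diff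
        eval_at_uminus a_def)
  have "eval_at (\<lambda>i. p $ i) f = eval_at b (Var k * A + C)"
    unfolding f_eq eval_at_substitute b_def ..
  also have "\<dots> = 0"
    using eval_at_form_eq_0[OF A(1) e b] eval_at_form_eq_0[OF C _ b]
    by (simp add: eval_at_add eval_at_mult)
  finally show "p \<in> hypersurface_points n f"
    using p k by (auto simp: hypersurface_points_def)
  have AC: "A + C \<in> polys ?V" using form_polys[OF A(1)] form_polys[OF C] by (rule add_in_polys)
  let ?\<theta> = "\<lambda>i. if i = k then 1 else Var i"
  let ?\<rho> = "\<lambda>i. Var i - Const (a i)"
  \<comment> \<open>Once \<open>x_k = 1\<close>, the shear acts as the translation by
    \<open>a\<close>.\<close>
  have \<theta>: "substitute ?\<theta> (lin n (shear k (\<lambda>i. - a i)) i) = (if i = k then 1 else ?\<rho> i)"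
    if "i \<le> n" for i
    using that k by (simp add: lin_shear substitute_add substitute_mult substitute_diff Const_uminus
        substitute_uminus)
  have \<rho>: "substitute (\<lambda>i. substitute ?\<theta> (lin n (shear k (\<lambda>i. - a i)) i)) G = substitute ?\<rho> G"
    if "G \<in> polys ?V" for G
    using that by (rule substitute_cong) (auto simp: \<theta>)
  have "dehomogenize k f = substitute ?\<rho> (A + C)"
    unfolding dehomogenize_def f_eq substitute_substitute
    using \<rho>[OF form_polys[OF A(1)]] \<rho>[OF form_polys[OF C]] k
    by (simp add: substitute_add substitute_mult \<theta>)
  moreover have "order_ge e (A + C)"
    using A(1) C by (intro order_ge_add) (auto intro: form_order_ge)
  ultimately have "Fraction_Field.Fract (dehomogenize k f) 1 \<in> local_max_ideal_power ?V a e"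
    "Fraction_Field.Fract (dehomogenize k f) 1 \<notin> local_max_ideal_power ?V a (Suc e)"
    using substitute_in_local_max_ideal_power[OF AC] not_in_local_max_ideal_power[OF A C] by auto
  then show "has_multiplicity n f p e"
    unfolding has_multiplicity_def a_def using k by blast
qed

text \<open>If already the first derivative along \<open>v\<close> vanishes, \<open>f\<close> is a
  cone. Otherwise \<open>v\<close> is a point of multiplicity \<open>d - 1\<close>, which is at
  least 2, contradicting \<open>sing\<close>.\<close>

lemma sebastiani_thom_type_if_degenerate_direction:
  assumes n: "n \<ge> 1" and d: "d \<ge> 3" and f: "form {..n} d f"
    and sing: "\<not> has_singularity_of_multiplicity n f (d - 1)"
    and k: "k \<le> n" "v k \<noteq> 0" and D: "dir_deriv n v (dir_deriv n v f) = 0"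
  shows "sebastiani_thom_type n d f"
proof (cases "dir_deriv n v f = 0")
  case True
  \<comment> \<open>Normalised to be a column of a shear. All second derivatives involving
    \<open>a\<close> vanish, so the set \<open>{k}\<close> splits off.\<close>
  define a where "a = (\<lambda>i. 1 / v k * v i)"
  have a: "a k = 1" using k by (simp add: a_def)
  have "dir_deriv n a f = 0" unfolding a_def dir_deriv_scale True by simp
  then have "dir_deriv n (\<lambda>i. shear k a i k) (dir_deriv n w f) = 0" for w
    by (subst dir_deriv_commute) (simp add: shear_column[of a k, OF a])
  moreover have "{k} \<noteq> {..n}"
  proof
    assume "{k} = {..n}"
    then have "card {..n} = 1" by (metis card_1_singleton_iff One_nat_def)
    then show False using n by simp
  qed
  ultimately show ?thesis
    using k by (intro sebastiani_thom_typeI[OF f right_inverse_shear[OF k(1), of a]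
        right_inverse_shear'[OF k(1), of a], of "{k}"]) auto
next
  case False
  define p where "p = vec (Suc n) v"
  have cong: "dir_deriv n (\<lambda>i. p $ i) g = dir_deriv n v g" for g
    unfolding dir_deriv_def by (intro sum.cong) (auto simp: p_def)
  have f': "form {..n} (Suc (d - 1)) f" using f d by simp
  have "p \<in> hypersurface_points n f \<and> has_multiplicity n f p (d - 1)"
  proof (rule singular_point_of_multiplicity[OF f'])
    show "p \<in> carrier_vec (Suc n)" "k \<le> n" "p $ k \<noteq> 0" "0 < d - 1"
      using k d by (auto simp: p_def)
  qed (use False D in \<open>simp_all only: cong not_False_eq_True\<close>)
  then have "has_singularity_of_multiplicity n f (d - 1)"
    using d by (auto simp: has_singularity_of_multiplicity_def)
  then show ?thesis using sing by blast
qed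

text \<open>The difference has vanishing partial derivatives, so no variable occurs in it; being a
  form of positive degree, it is zero.\<close>

lemma proportional_if_derivs_proportional:
  assumes f: "form {..n} d f" and g: "form {..n} d g" and d: "d > 0"
    and eq: "\<And>i. i \<le> n \<Longrightarrow> partial_deriv i g = Const c * partial_deriv i f"
  shows "g = Const c * f"
proof -
  define h where "h = g - Const c * f"
  have "form {..n} d h" unfolding h_def using f g by (intro form_diff form_Const_mult)
  moreover have "partial_deriv i h = 0" if "i \<le> n" for i
    unfolding h_def using eq[OF that] partial_deriv_add[of i "g - Const c * f" "Const c * f"]
    by (simp add: partial_deriv_Const_mult)
  ultimately have "mons h = {}"
  proof -
    assume h: "form {..n} d h" and D: "\<And>i. i \<le> n \<Longrightarrow> partial_deriv i h = 0"
    have "m \<notin> mons h" for m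
    proof
      assume m: "m \<in> mons h"
      have "Poly_Mapping.keys m \<noteq> {}" using m h d by (auto simp: form_def mon_degree_def)
      then obtain i where i: "i \<in> Poly_Mapping.keys m" by blast
      then have "i \<le> n" using m h by (auto simp: form_def polys_iff)
      from form_without_variable[OF h D[OF this]] show False
        using i m by (auto simp: form_def polys_iff)
    qed
    then show ?thesis by blast
  qed
  then show ?thesis by (simp add: h_def)
qed

text \<open>In the basis given by the columns of \<open>P\<close>, the \<open>i\<close>-th unit
  vector has the coordinates \<open>Q k i\<close>.\<close>

lemma partial_deriv_eq_sum_dir_deriv:
  assumes "right_inverse n P Q" "i \<le> n"
  shows "partial_deriv i f = (\<Sum>k\<le>n. Const (Q k i) * dir_deriv n (\<lambda>j. P j k) f)"
proof -
  have "(\<Sum>k\<le>n. Const (Q k i) * dir_deriv n (\<lambda>j. P j k) f)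
      = (\<Sum>k\<le>n. \<Sum>j\<le>n. Const (P j k * Q k i) * partial_deriv j f)"
    by (simp add: dir_deriv_def sum_distrib_left Const_mult mult_ac)
  also have "\<dots> = (\<Sum>j\<le>n. Const (\<Sum>k\<le>n. P j k * Q k i) * partial_deriv j f)"
    by (subst sum.swap) (simp add: Const_sum sum_distrib_right)
  also have "\<dots> = (\<Sum>j\<le>n. if j = i then partial_deriv i f else 0)"
    using assms by (intro sum.cong) (auto simp: right_inverse_def)
  finally show ?thesis using assms(2) by (simp add: sum.delta)
qed

theorem corollary1p2:
  fixes n d :: nat and f g :: cpoly
  assumes "n \<ge> 1" and "d \<ge> 3"
    and "homogeneous {..n} d f" and "homogeneous {..n} d g"
    and "jacobian_ideal n f = jacobian_ideal n g"
    and "\<not> (\<exists>c. c \<noteq> 0 \<and> f = Const c * g)"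
    and "\<not> has_singularity_of_multiplicity n f (d - 1)"
  shows "sebastiani_thom_type n d f"
proof -
  have f: "form {..n} d f" and g: "form {..n} d g" "g \<noteq> 0"
    using assms(3,4) by (auto simp: homogeneous_def)
  obtain B where B: "\<And>i. i \<le> n \<Longrightarrow> partial_deriv i g = (\<Sum>j\<le>n. Const (B i j) * partial_deriv j f)"
    using jacobian_ideal_eq_imp_linear_combination[OF f g(1) assms(5)] by metis
  \<comment> \<open>Transposed, because \<open>B\<close> acts on gradients and \<open>T\<close> on
    directions.\<close>
  define T where "T i j = B j i" for i j
  have dir_g: "dir_deriv n v g = dir_deriv n (\<lambda>i. \<Sum>j\<le>n. T i j * v j) f" for v
  proof -
    have "dir_deriv n v g = (\<Sum>j\<le>n. \<Sum>i\<le>n. Const (T i j * v j) * partial_deriv i f)"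
      by (simp add: dir_deriv_def B T_def sum_distrib_left Const_mult mult_ac)
    also have "\<dots> = dir_deriv n (\<lambda>i. \<Sum>j\<le>n. T i j * v j) f"
      by (subst sum.swap) (simp add: dir_deriv_def Const_sum sum_distrib_right)
    finally show ?thesis .
  qed
  have cong: "dir_deriv n v h = dir_deriv n w h" if "\<And>i. i \<le> n \<Longrightarrow> v i = w i" for v w h
    unfolding dir_deriv_def using that by (intro sum.cong) auto
  show ?thesis
  proof (cases rule: jordan_pair_or_eigenbasis[where T = T and n = n])
    case (jordan_pair v w a k)
    have v: "dir_deriv n v g = Const a * dir_deriv n v f"
      unfolding dir_g dir_deriv_scale[symmetric] by (rule cong) (rule jordan_pair)
    have "dir_deriv n w g = dir_deriv n (\<lambda>i. a * w i + v i) f"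
      unfolding dir_g by (rule cong) (rule jordan_pair)
    also have "\<dots> = Const a * dir_deriv n w f + dir_deriv n v f"
      by (simp add: dir_deriv_def Const_add Const_mult sum.distrib sum_distrib_left algebra_simps)
    finally have w: "dir_deriv n w g = Const a * dir_deriv n w f + dir_deriv n v f" .
    have "dir_deriv n v (dir_deriv n w g) = dir_deriv n w (dir_deriv n v g)"
      by (rule dir_deriv_commute)
    \<comment> \<open>The terms with factor \<open>a\<close> cancel because derivatives commute,
      leaving the second derivative along \<open>v\<close>.\<close>
    then have "dir_deriv n v (dir_deriv n v f) = 0"
      unfolding v w dir_deriv_add dir_deriv_Const_mult dir_deriv_commute[of n w v] by simp
    then show ?thesis
      by (rule sebastiani_thom_type_if_degenerate_direction[where v = v and k = k,
          OF assms(1,2) f assms(7) jordan_pair(1,2)])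
  next
    case (eigenbasis P Q \<mu>)
    let ?D = "\<lambda>k. dir_deriv n (\<lambda>i. P i k)"
    have D: "?D k g = Const (\<mu> k) * ?D k f" if "k \<le> n" for k
      unfolding dir_g dir_deriv_scale[symmetric] using that by (intro cong eigenbasis)
    \<comment> \<open>One eigenvalue class against all the others; index 0 guarantees that it is
      nonempty.\<close>
    define S where "S = {k. k \<le> n \<and> \<mu> k = \<mu> 0}"
    \<comment> \<open>A single eigenvalue would make \<open>g\<close> a multiple of
      \<open>f\<close>, with a nonzero scalar since \<open>g\<close> is nonzero; inverting it
      contradicts the assumption that \<open>f\<close> is no multiple of \<open>g\<close>.\<close>
    have "S \<noteq> {..n}"
    proof
      assume S: "S = {..n}"
      have "partial_deriv i g = Const (\<mu> 0) * partial_deriv i f" if "i \<le> n" for i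
      proof -
        have "?D k g = Const (\<mu> 0) * ?D k f" if "k \<le> n" for k
          using D[OF that] S that by (auto simp: S_def)
        then show ?thesis
          by (simp add: partial_deriv_eq_sum_dir_deriv[OF eigenbasis(1) that] sum_distrib_left
              mult.left_commute)
      qed
      then have g_eq: "g = Const (\<mu> 0) * f"
        using assms(2) by (intro proportional_if_derivs_proportional[OF f g(1)]) auto
      then have "\<mu> 0 \<noteq> 0" using g(2) by auto
      then have "f = Const (1 / \<mu> 0) * g"
        unfolding g_eq mult.assoc[symmetric] Const_mult[symmetric] by simp
      then show False using assms(6) \<open>\<mu> 0 \<noteq> 0\<close> by (metis divide_eq_0_iff zero_neq_one)
    qed
    then have "S \<subset> {..n}" "S \<noteq> {}" by (auto simp: S_def)
    moreover have "?D i (?D j f) = 0" if ij: "i \<in> S" "j \<in> {..n} - S" for i j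
    proof -
      have "i \<le> n" "j \<le> n" "\<mu> i \<noteq> \<mu> j" using ij by (auto simp: S_def)
      have "?D i (?D j g) = ?D j (?D i g)" by (rule dir_deriv_commute)
      \<comment> \<open>The two orders of differentiation put different eigenvalues in front of the
        same second derivative of \<open>f\<close>.\<close>
      then have "Const (\<mu> j) * ?D i (?D j f) = Const (\<mu> i) * ?D i (?D j f)"
        by (simp add: D \<open>i \<le> n\<close> \<open>j \<le> n\<close> dir_deriv_Const_mult dir_deriv_commute[of n "\<lambda>k. P k j"])
      then have "Const (\<mu> i - \<mu> j) * ?D i (?D j f) = 0"
        by (simp only: Const_diff left_diff_distrib diff_self)
      then show ?thesis using \<open>\<mu> i \<noteq> \<mu> j\<close> by simp
    qed
    ultimately show ?thesis
      by (rule sebastiani_thom_typeI[OF f eigenbasis(1,2)])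
  qed
qed

end
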